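(* The divergence operator $\delta:\mathcal{S}_{\mathfrak{h},\delta}\to\mathcal{B}(\mathfrak{H})$ is closable in the weak topology.
   Context: $\mathfrak{h}$ is a real separable Hilbert space, $\mathfrak{h}_{\mathbb C}$ its complexification with conjugation, $\mathfrak{H}=\Gamma_s(\mathfrak{h}_{\mathbb C})$ the symmetric Fock space with exponential vectors $\mathcal{E}(k)=\sum_n k^{\otimes n}/\sqrt{n!}$, inner products linear in the second argument; pairs $h=(h_1,h_2)$ denote elements of $\mathfrak{h}\otimes\mathbb{R}^2$ or $\mathfrak{h}_{\mathbb C}\otimes\mathbb{C}^2$. With $[a(h),a^+(k)]=\langle h,k\rangle$ set $Q(h)=a(\overline h)+a^+(h)$, $P(h)=i(a(\overline h)-a^+(h))$, $U(h_1,h_2)=\exp(iP(h_1)+iQ(h_2))$. Convention: $\sum_jX_jB_jY_j$ (with $X_j,Y_j$ defined with adjoints on exponential vectors, $B_j$ bounded) defines a bounded operator $M$ if $\langle\mathcal{E}(f),M\mathcal{E}(g)\rangle=\sum_j\langle X_j^*\mathcal{E}(f),B_jY_j\mathcal{E}(g)\rangle$ for all $f,g\in\mathfrak{h}_{\mathbb C}$. For $h\in\mathfrak{h}\otimes\mathbb{R}^2$, $\mathrm{Dom}\,O_h$ is the set of $\varphi:\mathbb{R}^2\to\mathbb{C}$ for which there is $M=:O_h(\varphi)\in\mathcal{B}(\mathfrak{H})$ with $\langle\mathcal{E}(k_1),M\mathcal{E}(k_2)\rangle=\frac1{2\pi}\int\langle\mathcal{E}(k_1),U(uh_1,vh_2)\mathcal{E}(k_2)\rangle\mathcal{F}^{-1}\varphi(u,v)\mathrm{d}u\mathrm{d}v$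 for all $k_1,k_2\in\mathfrak{h}_{\mathbb C}$, where $\mathcal{F}^{-1}\varphi(x,y)=\frac1{2\pi}\int\varphi(u,v)e^{-i(ux+vy)}\mathrm{d}u\mathrm{d}v$ (possibly a distribution). $\mathcal{S}$ is the algebra generated by all $O_h(\varphi)$ with $h\in\mathfrak{h}\otimes\mathbb{R}^2$ and $\varphi\in C^\infty(\mathbb{R}^2)$ all of whose partial derivatives (of all orders, including $0$) lie in $\mathrm{Dom}\,O_h$. For $k\in\mathfrak{h}_{\mathbb C}\otimes\mathbb{C}^2$ and $F\in\mathcal{S}$, $D_kF=\frac i2[Q(k_1)-P(k_2),F]$, which defines a bounded operator. $\mathcal{S}_{\mathfrak{h}}$ is the set of finite sums $u=\sum_{j=1}^nF_j\otimes h^{(j)}$ with $F_j\in\mathcal{S}$, $h^{(j)}\in\mathfrak{h}_{\mathbb C}\otimes\mathbb{C}^2$, viewed as a subspace of $\mathfrak{M}=\mathcal{B}(\mathfrak{H},\mathfrak{H}\otimes\mathfrak{h}_{\mathbb C}\otimes\mathbb{C}^2)$ via $(F\otimes h)\psi=F\psi\otimes h$. $\mathcal{S}_{\mathfrak{h},\delta}$ is the set of $u\in\mathcal{S}_{\mathfrak{h}}$ for which $$\delta(u)=\frac12\sum_{j=1}^n\big\{P(h^{(j)}_1)+Q(h^{(j)}_2),F_j\big\}-\sum_{j=1}^nD_{h^{(j)}}F_j$$ defines a bounded operator on $\mathfrak{H}$, where $\{X,Y\}=XY+YX$; this bounded operator is $\delta(u)$. Closability means: if $(u_n)_{n\in\mathbb{N}}\subseteq\mathcal{S}_{\mathfrak{h},\delta}$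 with $u_n\to0$ weakly in $\mathfrak{M}$ and $\delta(u_n)\to\beta\in\mathcal{B}(\mathfrak{H})$ weakly, then $\beta=0$. *)

theory Defs
  imports "HOL-Analysis.Analysis" "HOL-Library.Multiset"
begin

section \<open>Complex inner product spaces\<close>

class complex_inner = real_inner +
  fixes scaleC :: "complex \<Rightarrow> 'a \<Rightarrow> 'a"  (infixr \<open>*\<^sub>C\<close> 75)
    and cinner :: "'a \<Rightarrow> 'a \<Rightarrow> complex"
  assumes scaleR_scaleC: "r *\<^sub>R x = complex_of_real r *\<^sub>C x"
    and scaleC_add_right: "c *\<^sub>C (x + y) = c *\<^sub>C x + c *\<^sub>C y"
    and scaleC_add_left: "(c + d) *\<^sub>C x = c *\<^sub>C x + d *\<^sub>C x"
    and scaleC_scaleC: "c *\<^sub>C d *\<^sub>C x = (c * d) *\<^sub>C x"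
    and cinner_commute: "cinner x y = cnj (cinner y x)"
    and cinner_add_right: "cinner x (y + z) = cinner x y + cinner x z"
    and cinner_scaleC_right: "cinner x (c *\<^sub>C y) = c * cinner x y"
    and inner_eq_Re_cinner: "inner x y = Re (cinner x y)"

lemma cinner_scaleC_left: "cinner (c *\<^sub>C x) (y::'a::complex_inner) = cnj c * cinner x y"
  by (metis cinner_commute cinner_scaleC_right complex_cnj_mult)

lemma cinner_add_left: "cinner (x + y) (z::'a::complex_inner) = cinner x z + cinner y z"
  by (metis cinner_add_right cinner_commute complex_cnj_add)

lemma cinner_self: "cinner x (x::'a::complex_inner) = complex_of_real ((norm x)\<^sup>2)"
proof -
  have "Im (cinner x x) = 0"
    using cinner_commute[of x x] by (metis complex_cnj_cancel_iff Reals_cnj_iff complex_is_Real_iff)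
  then show ?thesis
    by (simp add: complex_eq_iff flip: inner_eq_Re_cinner power2_norm_eq_inner)
qed

lemma norm_scaleC: "norm (c *\<^sub>C (x::'a::complex_inner)) = cmod c * norm x"
proof -
  have "complex_of_real ((norm (c *\<^sub>C x))\<^sup>2) = (c * cnj c) * complex_of_real ((norm x)\<^sup>2)"
    unfolding cinner_self[symmetric] cinner_scaleC_left cinner_scaleC_right by simp
  also have "\<dots> = complex_of_real ((cmod c * norm x)\<^sup>2)"
    by (simp add: power_mult_distrib flip: complex_norm_square)
  finally have "(norm (c *\<^sub>C x))\<^sup>2 = (cmod c * norm x)\<^sup>2"
    using of_real_eq_iff by blast
  then show ?thesis
    by (simp add: power2_eq_iff_nonneg)
qed

lemma scaleC_zero: "c *\<^sub>C (0::'a::complex_inner) = 0"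
  using norm_scaleC[of c "0::'a"] by simp

lemma norm_cinner_le: "cmod (cinner x (y::'a::complex_inner)) \<le> norm x * norm y"
proof (cases "cinner x y = 0")
  case False
  define c where "c = cnj (sgn (cinner x y))"
  have c: "cmod c = 1" using False by (simp add: c_def norm_sgn)
  have "complex_of_real (cmod (cinner x y)) = c * cinner x y"
    using False by (simp add: c_def sgn_eq field_simps flip: complex_norm_square)
      (simp add: power2_eq_square)
  also have "\<dots> = cinner x (c *\<^sub>C y)" by (simp add: cinner_scaleC_right)
  finally have "cmod (cinner x y) = inner x (c *\<^sub>C y)"
    by (metis Re_complex_of_real inner_eq_Re_cinner)
  also have "\<dots> \<le> norm x * norm (c *\<^sub>C y)" by (rule norm_cauchy_schwarz)
  finally show ?thesis by (simp add: norm_scaleC c)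
qed simp

instantiation complex :: complex_inner
begin
definition scaleC_complex :: "complex \<Rightarrow> complex \<Rightarrow> complex" where "scaleC_complex c x = c * x"
definition cinner_complex :: "complex \<Rightarrow> complex \<Rightarrow> complex" where "cinner_complex x y = cnj x * y"
instance
  by standard (auto simp: scaleC_complex_def cinner_complex_def algebra_simps scaleR_conv_of_real
      inner_complex_def)
end

instantiation prod :: (complex_inner, complex_inner) complex_inner
begin
definition scaleC_prod :: "complex \<Rightarrow> 'a \<times> 'b \<Rightarrow> 'a \<times> 'b"
  where "scaleC_prod c x = (c *\<^sub>C fst x, c *\<^sub>C snd x)"
definition cinner_prod :: "'a \<times> 'b \<Rightarrow> 'a \<times> 'b \<Rightarrow> complex"
  where "cinner_prod x y = cinner (fst x) (fst y) + cinner (snd x) (snd y)"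
instance
proof
  fix x y z :: "'a \<times> 'b" and r :: real and c d :: complex
  show "r *\<^sub>R x = complex_of_real r *\<^sub>C x"
    by (simp add: scaleC_prod_def scaleR_prod_def scaleR_scaleC)
  show "c *\<^sub>C (x + y) = c *\<^sub>C x + c *\<^sub>C y" "(c + d) *\<^sub>C x = c *\<^sub>C x + d *\<^sub>C x"
    by (simp_all add: scaleC_prod_def plus_prod_def scaleC_add_right scaleC_add_left)
  show "c *\<^sub>C d *\<^sub>C x = (c * d) *\<^sub>C x"
    by (simp add: scaleC_prod_def scaleC_scaleC)
  show "cinner x y = cnj (cinner y x)"
    unfolding cinner_prod_def complex_cnj_add by (metis cinner_commute)
  show "cinner x (y + z) = cinner x y + cinner x z"
    by (simp add: cinner_prod_def cinner_add_right)
  show "cinner x (c *\<^sub>C y) = c * cinner x y"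
    by (simp add: cinner_prod_def scaleC_prod_def cinner_scaleC_right algebra_simps)
  show "inner x y = Re (cinner x y)"
    by (simp add: cinner_prod_def inner_prod_def inner_eq_Re_cinner)
qed
end

definition bounded_clinear :: "('a::complex_inner \<Rightarrow> 'b::complex_inner) \<Rightarrow> bool" where
  "bounded_clinear T \<longleftrightarrow> bounded_linear T \<and> (\<forall>c x. T (c *\<^sub>C x) = c *\<^sub>C T x)"

(* convergence of sequences of operators in the weak operator topology *)
definition weakly_tends ::
    "(nat \<Rightarrow> 'a::complex_inner \<Rightarrow> 'b::complex_inner) \<Rightarrow> ('a \<Rightarrow> 'b) \<Rightarrow> bool" where
  "weakly_tends T L \<longleftrightarrow> (\<forall>\<Phi> \<psi>. (\<lambda>n. cinner \<Phi> (T n \<psi>)) \<longlonglongrightarrow> cinner \<Phi> (L \<psi>))"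


section \<open>Square summable families\<close>

definition square_summable :: "('i \<Rightarrow> 'a::complex_inner) \<Rightarrow> bool" where
  "square_summable f \<longleftrightarrow> (\<lambda>i. (norm (f i))\<^sup>2) summable_on UNIV"

definition l2_cinner :: "('i \<Rightarrow> 'a::complex_inner) \<Rightarrow> ('i \<Rightarrow> 'a) \<Rightarrow> complex" where
  "l2_cinner f g = (\<Sum>\<^sub>\<infinity>i. cinner (f i) (g i))"

lemma square_summable_zero: "square_summable (\<lambda>_. 0)"
  by (simp add: square_summable_def)

lemma square_summable_scaleC: "square_summable f \<Longrightarrow> square_summable (\<lambda>i. c *\<^sub>C f i)"
  by (simp add: square_summable_def norm_scaleC power_mult_distrib summable_on_cmult_right)

lemma square_summable_scaleR: "square_summable f \<Longrightarrow> square_summable (\<lambda>i. r *\<^sub>R f i)"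
  by (simp add: scaleR_scaleC square_summable_scaleC)

lemma square_summable_uminus: "square_summable f \<Longrightarrow> square_summable (\<lambda>i. - f i)"
  by (simp add: square_summable_def)

lemma square_summable_add:
  assumes "square_summable f" "square_summable g"
  shows "square_summable (\<lambda>i. f i + g i)"
proof -
  have "(\<lambda>i. 2 * (norm (f i))\<^sup>2 + 2 * (norm (g i))\<^sup>2) summable_on UNIV"
    using assms by (intro summable_on_add summable_on_cmult_right) (auto simp: square_summable_def)
  moreover have "(norm (f i + g i))\<^sup>2 \<le> 2 * (norm (f i))\<^sup>2 + 2 * (norm (g i))\<^sup>2" for i
  proof -
    have "(norm (f i + g i))\<^sup>2 \<le> (norm (f i) + norm (g i))\<^sup>2"
      by (simp add: norm_triangle_ineq power_mono)
    also have "\<dots> \<le> 2 * (norm (f i))\<^sup>2 + 2 * (norm (g i))\<^sup>2"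
      using zero_le_power2[of "norm (f i) - norm (g i)"]
      by (simp add: power2_eq_square algebra_simps)
    finally show ?thesis .
  qed
  ultimately show ?thesis
    unfolding square_summable_def by (rule summable_on_comparison_test) auto
qed

lemma square_summable_diff:
  assumes "square_summable f" "square_summable g"
  shows "square_summable (\<lambda>i. f i - g i)"
  using square_summable_add[OF assms(1) square_summable_uminus[OF assms(2)]] by simp

lemma summable_cinner:
  assumes "square_summable f" "square_summable g"
  shows "(\<lambda>i. cinner (f i) (g i)) summable_on UNIV"
proof -
  have "(\<lambda>i. (norm (f i))\<^sup>2 + (norm (g i))\<^sup>2) summable_on UNIV"
    using assms by (intro summable_on_add) (auto simp: square_summable_def)
  moreover have "cmod (cinner (f i) (g i)) \<le> (norm (f i))\<^sup>2 + (norm (g i))\<^sup>2" for i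
  proof -
    have "0 \<le> (norm (f i) - norm (g i))\<^sup>2" "0 \<le> norm (f i) * norm (g i)" by simp_all
    then have "norm (f i) * norm (g i) \<le> (norm (f i))\<^sup>2 + (norm (g i))\<^sup>2"
      unfolding power2_diff by linarith
    with norm_cinner_le[of "f i" "g i"] show ?thesis by linarith
  qed
  ultimately have "(\<lambda>i. cmod (cinner (f i) (g i))) summable_on UNIV"
    by (rule summable_on_comparison_test) auto
  then show ?thesis by (rule abs_summable_summable)
qed

lemma l2_cinner_commute: "l2_cinner f g = cnj (l2_cinner g f)"
  unfolding l2_cinner_def infsum_cnj[symmetric] by (metis cinner_commute)

lemma l2_cinner_add_right:
  assumes "square_summable f" "square_summable g" "square_summable h"
  shows "l2_cinner f (\<lambda>i. g i + h i) = l2_cinner f g + l2_cinner f h"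
  unfolding l2_cinner_def cinner_add_right
  by (intro infsum_add summable_cinner assms)

lemma l2_cinner_scaleC_right: "l2_cinner f (\<lambda>i. c *\<^sub>C g i) = c * l2_cinner f g"
  unfolding l2_cinner_def cinner_scaleC_right by (rule infsum_cmult_right')

lemma l2_cinner_self:
  assumes "square_summable f"
  shows "l2_cinner f f = complex_of_real (\<Sum>\<^sub>\<infinity>i. (norm (f i))\<^sup>2)"
  unfolding l2_cinner_def cinner_self
  by (rule infsumI[OF has_sum_of_real[OF has_sum_infsum]])
     (use assms in \<open>simp add: square_summable_def\<close>)

lemma l2_cinner_ge_0: "square_summable f \<Longrightarrow> 0 \<le> Re (l2_cinner f f)"
  by (simp add: l2_cinner_self infsum_nonneg)

lemma l2_cinner_eq_0_iff:
  assumes "square_summable f"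
  shows "Re (l2_cinner f f) = 0 \<longleftrightarrow> f = (\<lambda>_. 0)"
proof
  assume "Re (l2_cinner f f) = 0"
  then have "(\<Sum>\<^sub>\<infinity>i. (norm (f i))\<^sup>2) \<le> 0" using assms by (simp add: l2_cinner_self)
  then have "(norm (f i))\<^sup>2 = 0" for i
    by (rule nonneg_infsum_le_0D) (use assms in \<open>auto simp: square_summable_def\<close>)
  then show "f = (\<lambda>_. 0)" by auto
qed (simp add: l2_cinner_def cinner_self)


section \<open>Complexification, tensor product and symmetric Fock space\<close>

text \<open>
  Throughout, a real Hilbert space carries one fixed orthonormal basis \<open>onb\<close>.  Only the coordinates
  of tensors refer to it; another choice yields unitarily equivalent spaces and the same
  operators.
\<close>

definition orthonormal_basis :: "'a::real_inner set \<Rightarrow> bool" where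
  "orthonormal_basis B \<longleftrightarrow>
     pairwise orthogonal B \<and> (\<forall>b\<in>B. norm b = 1) \<and> closure (span B) = UNIV"

definition onb :: "'a::real_inner set" where
  "onb = (SOME B. orthonormal_basis B)"

(* the pair (x, y) stands for x + iy in the complexification *)
type_synonym 'a cpx = "'a \<times> 'a"

definition of_h :: "'a::real_inner \<Rightarrow> 'a cpx" where
  "of_h x = (x, 0)"

definition conj_h :: "'a::real_inner cpx \<Rightarrow> 'a cpx" where
  "conj_h k = (fst k, - snd k)"

definition inner_h :: "'a::real_inner cpx \<Rightarrow> 'a cpx \<Rightarrow> complex" where
  "inner_h k l = Complex (inner (fst k) (fst l) + inner (snd k) (snd l))
                         (inner (fst k) (snd l) - inner (snd k) (fst l))"

(* The Hilbert space tensor product of 'h with the complexification of 'a: Phi is given by its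
   coefficients Phi b with respect to the vectors b of the basis. *)
typedef (overloaded) ('h, 'a) htensor =
    "{\<Phi> :: 'a::real_inner \<Rightarrow> 'h::complex_inner. square_summable \<Phi> \<and> (\<forall>b. b \<notin> onb \<longrightarrow> \<Phi> b = 0)}"
  morphisms tensor_coeff Abs_htensor
  by (rule exI[of _ "\<lambda>_. 0"]) (simp add: square_summable_zero)

setup_lifting type_definition_htensor

instantiation htensor :: (complex_inner, real_inner) complex_inner
begin

lift_definition zero_htensor :: "('a, 'b) htensor" is "\<lambda>_. 0"
  by (simp add: square_summable_zero)
lift_definition plus_htensor :: "('a, 'b) htensor \<Rightarrow> ('a, 'b) htensor \<Rightarrow> ('a, 'b) htensor"
  is "\<lambda>f g b. f b + g b" by (simp add: square_summable_add)
lift_definition minus_htensor :: "('a, 'b) htensor \<Rightarrow> ('a, 'b) htensor \<Rightarrow> ('a, 'b) htensor"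
  is "\<lambda>f g b. f b - g b" by (simp add: square_summable_diff)
lift_definition uminus_htensor :: "('a, 'b) htensor \<Rightarrow> ('a, 'b) htensor"
  is "\<lambda>f b. - f b" by (simp add: square_summable_uminus)
lift_definition scaleR_htensor :: "real \<Rightarrow> ('a, 'b) htensor \<Rightarrow> ('a, 'b) htensor"
  is "\<lambda>r f b. r *\<^sub>R f b" by (simp add: square_summable_scaleR)
lift_definition scaleC_htensor :: "complex \<Rightarrow> ('a, 'b) htensor \<Rightarrow> ('a, 'b) htensor"
  is "\<lambda>c f b. c *\<^sub>C f b"
  by (simp add: square_summable_scaleC scaleC_zero)
lift_definition cinner_htensor :: "('a, 'b) htensor \<Rightarrow> ('a, 'b) htensor \<Rightarrow> complex"
  is l2_cinner .
definition inner_htensor :: "('a, 'b) htensor \<Rightarrow> ('a, 'b) htensor \<Rightarrow> real"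
  where "inner_htensor x y = Re (cinner x y)"
definition norm_htensor :: "('a, 'b) htensor \<Rightarrow> real"
  where "norm_htensor x = sqrt (inner x x)"
definition dist_htensor :: "('a, 'b) htensor \<Rightarrow> ('a, 'b) htensor \<Rightarrow> real"
  where "dist_htensor x y = norm (x - y)"
definition sgn_htensor :: "('a, 'b) htensor \<Rightarrow> ('a, 'b) htensor"
  where "sgn_htensor x = inverse (norm x) *\<^sub>R x"
definition uniformity_htensor :: "(('a, 'b) htensor \<times> ('a, 'b) htensor) filter"
  where "uniformity_htensor = (INF e\<in>{0<..}. principal {(x, y). dist x y < e})"
definition open_htensor :: "('a, 'b) htensor set \<Rightarrow> bool"
  where "open_htensor S = (\<forall>x\<in>S. \<forall>\<^sub>F (x', y) in uniformity. x' = x \<longrightarrow> y \<in> S)"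

instance
proof
  fix x y z :: "('a, 'b) htensor" and r s :: real and c d :: complex
  show "x + y + z = x + (y + z)" "x + y = y + x" "0 + x = x" "- x + x = 0" "x - y = x + - y"
    by (transfer, simp add: algebra_simps)+
  show "r *\<^sub>R (x + y) = r *\<^sub>R x + r *\<^sub>R y" "(r + s) *\<^sub>R x = r *\<^sub>R x + s *\<^sub>R x"
    "r *\<^sub>R s *\<^sub>R x = (r * s) *\<^sub>R x" "1 *\<^sub>R x = x"
    by (transfer, simp add: algebra_simps)+
  show R: "r *\<^sub>R x = complex_of_real r *\<^sub>C x" for r and x :: "('a, 'b) htensor"
    by transfer (simp add: scaleR_scaleC)
  show "c *\<^sub>C (x + y) = c *\<^sub>C x + c *\<^sub>C y" "(c + d) *\<^sub>C x = c *\<^sub>C x + d *\<^sub>C x"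
    "c *\<^sub>C d *\<^sub>C x = (c * d) *\<^sub>C x"
    by (transfer, simp add: scaleC_add_right scaleC_add_left scaleC_scaleC)+
  show comm: "cinner x y = cnj (cinner y x)" for x y :: "('a, 'b) htensor"
    by transfer (rule l2_cinner_commute)
  show add: "cinner x (y + z) = cinner x y + cinner x z" for x y z :: "('a, 'b) htensor"
    by transfer (simp add: l2_cinner_add_right)
  show scale: "cinner x (c *\<^sub>C y) = c * cinner x y" for c and x y :: "('a, 'b) htensor"
    by transfer (rule l2_cinner_scaleC_right)
  show "inner x y = Re (cinner x y)" "norm x = sqrt (inner x x)" "dist x y = norm (x - y)"
    "sgn x = inverse (norm x) *\<^sub>R x"
    by (simp_all add: inner_htensor_def norm_htensor_def dist_htensor_def sgn_htensor_def)
  show comm': "inner x y = inner y x" for x y :: "('a, 'b) htensor"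
    unfolding inner_htensor_def by (subst comm) simp
  show "inner (x + y) z = inner x z + inner y z"
    unfolding comm'[of _ z] by (simp add: inner_htensor_def add)
  show "inner (r *\<^sub>R x) y = r * inner x y"
    unfolding comm'[of _ y] by (simp add: inner_htensor_def R scale)
  show "0 \<le> inner x x"
    unfolding inner_htensor_def by transfer (simp add: l2_cinner_ge_0)
  show "inner x x = 0 \<longleftrightarrow> x = 0"
    unfolding inner_htensor_def by transfer (simp add: l2_cinner_eq_0_iff)
qed (simp_all only: uniformity_htensor_def open_htensor_def)

end

text \<open>
  The symmetric Fock space over the complexification of \<^typ>\<open>'a\<close>: the Hilbert sum of the symmetric
  tensor powers.  The \<open>n\<close>-particle component of \<open>\<psi>\<close> is recorded by its coefficients
  \<open>\<psi> [b\<^sub>1, \<dots>, b\<^sub>n] = \<langle>b\<^sub>1 \<otimes> \<dots> \<otimes> b\<^sub>n, \<psi>\<rangle>\<close>, where \<open>b\<^sub>1, \<dots>, b\<^sub>n\<close> run through the basis.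
\<close>

definition fock_functions :: "('a::real_inner list \<Rightarrow> complex) set" where
  "fock_functions = {\<psi>. square_summable \<psi> \<and> (\<forall>bs. \<not> set bs \<subseteq> onb \<longrightarrow> \<psi> bs = 0) \<and>
     (\<forall>bs cs. mset bs = mset cs \<longrightarrow> \<psi> bs = \<psi> cs)}"

typedef (overloaded) 'a fock = "fock_functions :: ('a::real_inner list \<Rightarrow> complex) set"
  morphisms fock_coeff Abs_fock
  by (rule exI[of _ "\<lambda>_. 0"]) (simp add: fock_functions_def square_summable_zero)

setup_lifting type_definition_fock

lemma fock_functions_perm: "f \<in> fock_functions \<Longrightarrow> mset bs = mset cs \<Longrightarrow> f bs = f cs"
  unfolding fock_functions_def by blast

lemma fock_functions_map2:
  assumes f: "f \<in> fock_functions" and g: "g \<in> fock_functions" and "H 0 0 = 0"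
    and "square_summable (\<lambda>bs. H (f bs) (g bs))"
  shows "(\<lambda>bs. H (f bs) (g bs)) \<in> fock_functions"
  unfolding fock_functions_def
proof (intro CollectI conjI allI impI)
  show "H (f bs) (g bs) = H (f cs) (g cs)" if m: "mset bs = mset cs" for bs cs
    by (simp only: fock_functions_perm[OF f m] fock_functions_perm[OF g m])
  show "H (f bs) (g bs) = 0" if "\<not> set bs \<subseteq> onb" for bs
    using f g that assms(3) by (simp add: fock_functions_def)
qed (rule assms(4))

lemma fock_functionsD: "\<psi> \<in> fock_functions \<Longrightarrow> square_summable \<psi>"
  by (simp add: fock_functions_def)

instantiation fock :: (real_inner) complex_inner
begin

lift_definition zero_fock :: "'a fock" is "\<lambda>_. 0"
  by (simp add: fock_functions_def square_summable_zero)
lift_definition plus_fock :: "'a fock \<Rightarrow> 'a fock \<Rightarrow> 'a fock" is "\<lambda>f g b. f b + g b"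
  by (rule fock_functions_map2) (simp_all add: fock_functionsD square_summable_add)
lift_definition minus_fock :: "'a fock \<Rightarrow> 'a fock \<Rightarrow> 'a fock" is "\<lambda>f g b. f b - g b"
  by (rule fock_functions_map2) (simp_all add: fock_functionsD square_summable_diff)
lift_definition uminus_fock :: "'a fock \<Rightarrow> 'a fock" is "\<lambda>f b. - f b"
  by (rule fock_functions_map2[where H = "\<lambda>x _. - x"])
     (simp_all add: fock_functionsD square_summable_uminus)
lift_definition scaleR_fock :: "real \<Rightarrow> 'a fock \<Rightarrow> 'a fock" is "\<lambda>r f b. r *\<^sub>R f b"
  subgoal for r f
    by (rule fock_functions_map2[of f f "\<lambda>x _. r *\<^sub>R x"])
       (auto intro: fock_functionsD square_summable_scaleR)
  done
lift_definition scaleC_fock :: "complex \<Rightarrow> 'a fock \<Rightarrow> 'a fock" is "\<lambda>c f b. c *\<^sub>C f b"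
  subgoal for c f
    by (rule fock_functions_map2[of f f "\<lambda>x _. c *\<^sub>C x"])
       (auto intro: fock_functionsD square_summable_scaleC simp: scaleC_zero)
  done
lift_definition cinner_fock :: "'a fock \<Rightarrow> 'a fock \<Rightarrow> complex" is l2_cinner .
definition inner_fock :: "'a fock \<Rightarrow> 'a fock \<Rightarrow> real"
  where "inner_fock x y = Re (cinner x y)"
definition norm_fock :: "'a fock \<Rightarrow> real"
  where "norm_fock x = sqrt (inner x x)"
definition dist_fock :: "'a fock \<Rightarrow> 'a fock \<Rightarrow> real"
  where "dist_fock x y = norm (x - y)"
definition sgn_fock :: "'a fock \<Rightarrow> 'a fock"
  where "sgn_fock x = inverse (norm x) *\<^sub>R x"
definition uniformity_fock :: "('a fock \<times> 'a fock) filter"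
  where "uniformity_fock = (INF e\<in>{0<..}. principal {(x, y). dist x y < e})"
definition open_fock :: "'a fock set \<Rightarrow> bool"
  where "open_fock S = (\<forall>x\<in>S. \<forall>\<^sub>F (x', y) in uniformity. x' = x \<longrightarrow> y \<in> S)"

instance
proof
  fix x y z :: "'a fock" and r s :: real and c d :: complex
  show "x + y + z = x + (y + z)" "x + y = y + x" "0 + x = x" "- x + x = 0" "x - y = x + - y"
    by (transfer, simp add: algebra_simps)+
  show "r *\<^sub>R (x + y) = r *\<^sub>R x + r *\<^sub>R y" "(r + s) *\<^sub>R x = r *\<^sub>R x + s *\<^sub>R x"
    "r *\<^sub>R s *\<^sub>R x = (r * s) *\<^sub>R x" "1 *\<^sub>R x = x"
    by (transfer, simp add: algebra_simps)+
  show R: "r *\<^sub>R x = complex_of_real r *\<^sub>C x" for r and x :: "'a fock"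
    by transfer (simp only: scaleR_scaleC)
  show "c *\<^sub>C (x + y) = c *\<^sub>C x + c *\<^sub>C y" "(c + d) *\<^sub>C x = c *\<^sub>C x + d *\<^sub>C x"
    "c *\<^sub>C d *\<^sub>C x = (c * d) *\<^sub>C x"
    by (transfer, simp add: scaleC_add_right scaleC_add_left scaleC_scaleC)+
  show comm: "cinner x y = cnj (cinner y x)" for x y :: "'a fock"
    by transfer (rule l2_cinner_commute)
  show add: "cinner x (y + z) = cinner x y + cinner x z" for x y z :: "'a fock"
    by transfer (simp add: l2_cinner_add_right fock_functionsD)
  show scale: "cinner x (c *\<^sub>C y) = c * cinner x y" for c and x y :: "'a fock"
    by transfer (rule l2_cinner_scaleC_right)
  show "inner x y = Re (cinner x y)" "norm x = sqrt (inner x x)" "dist x y = norm (x - y)"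
    "sgn x = inverse (norm x) *\<^sub>R x"
    by (simp_all add: inner_fock_def norm_fock_def dist_fock_def sgn_fock_def)
  show comm': "inner x y = inner y x" for x y :: "'a fock"
    unfolding inner_fock_def by (subst comm) simp
  show "inner (x + y) z = inner x z + inner y z"
    unfolding comm'[of _ z] by (simp add: inner_fock_def add)
  show "inner (r *\<^sub>R x) y = r * inner x y"
    unfolding comm'[of _ y] by (simp add: inner_fock_def R scale)
  show "0 \<le> inner x x"
    unfolding inner_fock_def by transfer (simp add: l2_cinner_ge_0 fock_functionsD)
  show "inner x x = 0 \<longleftrightarrow> x = 0"
    unfolding inner_fock_def by transfer (simp add: l2_cinner_eq_0_iff fock_functionsD)
qed (simp_all only: uniformity_fock_def open_fock_def)

end


section \<open>Operators on Fock space\<close>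

text \<open>
  Unbounded operators are total functions that take the value \<open>0\<close> outside the natural domain.
\<close>

definition to_fock :: "('a::real_inner list \<Rightarrow> complex) \<Rightarrow> 'a fock" where
  "to_fock \<psi> = (if \<psi> \<in> fock_functions then Abs_fock \<psi> else 0)"

definition tensor_power :: "nat \<Rightarrow> 'a::real_inner cpx \<Rightarrow> 'a fock" where
  "tensor_power n k =
     to_fock (\<lambda>bs. if set bs \<subseteq> onb \<and> length bs = n then \<Prod>b\<leftarrow>bs. inner_h (of_h b) k else 0)"

definition exp_vec :: "'a::real_inner cpx \<Rightarrow> 'a fock" where
  "exp_vec k = (\<Sum>n. (1 / sqrt (fact n)) *\<^sub>R tensor_power n k)"

definition annih :: "'a::real_inner cpx \<Rightarrow> 'a fock \<Rightarrow> 'a fock" where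
  "annih h \<psi> = to_fock (\<lambda>bs. complex_of_real (sqrt (real (length bs + 1))) *
     (\<Sum>\<^sub>\<infinity>b\<in>onb. inner_h h (of_h b) * fock_coeff \<psi> (b # bs)))"

definition creat :: "'a::real_inner cpx \<Rightarrow> 'a fock \<Rightarrow> 'a fock" where
  "creat h \<psi> = to_fock (\<lambda>bs. if set bs \<subseteq> onb
     then complex_of_real (1 / sqrt (real (length bs))) *
       (\<Sum>j<length bs. inner_h (of_h (bs ! j)) h * fock_coeff \<psi> (take j bs @ drop (Suc j) bs))
     else 0)"

definition Q_op :: "'a::real_inner cpx \<Rightarrow> 'a fock \<Rightarrow> 'a fock" where
  "Q_op h \<psi> = annih (conj_h h) \<psi> + creat h \<psi>"

definition P_op :: "'a::real_inner cpx \<Rightarrow> 'a fock \<Rightarrow> 'a fock" where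
  "P_op h \<psi> = \<i> *\<^sub>C (annih (conj_h h) \<psi> - creat h \<psi>)"

text \<open>
  The unitary \<open>exp (i P(h\<^sub>1) + i Q(h\<^sub>2))\<close> is only ever applied to exponential vectors; these are
  analytic for the exponent, so that the exponential series converges on them.
\<close>

definition U_op :: "'a::real_inner \<Rightarrow> 'a \<Rightarrow> 'a fock \<Rightarrow> 'a fock" where
  "U_op h\<^sub>1 h\<^sub>2 \<psi> =
     (\<Sum>n. (1 / fact n) *\<^sub>R ((\<lambda>\<eta>. \<i> *\<^sub>C P_op (of_h h\<^sub>1) \<eta> + \<i> *\<^sub>C Q_op (of_h h\<^sub>2) \<eta>) ^^ n) \<psi>)"

text \<open>
  \<open>adj_exp X f\<close> is the value of the adjoint of \<open>X\<close> at the exponential vector of \<open>f\<close>, where \<open>X\<close> is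
  taken on the linear span of the exponential vectors.  A list of triples \<open>(X, B, Y)\<close> stands for
  the formal sum of the products \<open>X B Y\<close>.
\<close>

definition adj_exp :: "('a::real_inner fock \<Rightarrow> 'a fock) \<Rightarrow> 'a cpx \<Rightarrow> 'a fock" where
  "adj_exp X f = (THE w. \<forall>g. cinner w (exp_vec g) = cinner (exp_vec f) (X (exp_vec g)))"

type_synonym 'a formal_op =
  "(('a fock \<Rightarrow> 'a fock) \<times> ('a fock \<Rightarrow> 'a fock) \<times> ('a fock \<Rightarrow> 'a fock)) list"

definition defines_bounded :: "'a::real_inner formal_op \<Rightarrow> ('a fock \<Rightarrow> 'a fock) \<Rightarrow> bool" where
  "defines_bounded S M \<longleftrightarrow> bounded_clinear M \<and>
     (\<forall>f g. cinner (exp_vec f) (M (exp_vec g)) =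
       (\<Sum>(X, B, Y)\<leftarrow>S. cinner (adj_exp X f) (B (Y (exp_vec g)))))"


section \<open>The functional calculus and the algebra of smooth operators\<close>

text \<open>
  \<open>pairing_inv_fourier \<phi> g I\<close> says that \<open>\<integral> g(w) \<F>\<^sup>-\<^sup>1\<phi>(w) dw = I\<close>.  As \<open>\<F>\<^sup>-\<^sup>1\<phi>\<close> may be a distribution,
  this means \<open>\<langle>\<F>\<^sup>-\<^sup>1\<phi>, g\<rangle> = \<langle>\<phi>, \<F>\<^sup>-\<^sup>1g\<rangle>\<close>, with
  \<open>\<F>\<^sup>-\<^sup>1g(z) = 1/(2\<pi>) \<integral> g(w) exp(-i w\<bullet>z) dw\<close> as for \<open>\<phi>\<close>.  Here \<open>\<F>\<^sup>-\<^sup>1g\<close> is a complex measure, written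
  with a density \<open>f\<close> with respect to a finite measure \<open>\<mu>\<close>, and is determined by
  \<open>g = \<F>(\<F>\<^sup>-\<^sup>1g)\<close>.  For the matrix elements of \<open>U(u h\<^sub>1, v h\<^sub>2)\<close> it is a Gaussian density unless
  \<open>h\<^sub>1 = 0\<close> or \<open>h\<^sub>2 = 0\<close>; in these cases they do not decay in all directions and the measure is
  singular.  If \<open>\<F>\<^sup>-\<^sup>1\<phi>\<close> is an integrable function with \<open>\<phi> = \<F>(\<F>\<^sup>-\<^sup>1\<phi>)\<close>, then by Fubini \<open>I\<close> is the
  ordinary integral.
\<close>

definition pairing_inv_fourier ::
    "(real \<times> real \<Rightarrow> complex) \<Rightarrow> (real \<times> real \<Rightarrow> complex) \<Rightarrow> complex \<Rightarrow> bool" where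
  "pairing_inv_fourier \<phi> g I \<longleftrightarrow>
     (\<exists>(\<mu> :: (real \<times> real) measure) f. sets \<mu> = sets borel \<and> finite_measure \<mu> \<and> integrable \<mu> f \<and>
        (\<forall>w. g w = complex_of_real (1 / (2 * pi)) *
               (LINT z|\<mu>. f z * exp (\<i> * complex_of_real (inner w z)))) \<and>
        integrable \<mu> (\<lambda>z. \<phi> z * f z) \<and> I = (LINT z|\<mu>. \<phi> z * f z))"

definition is_O :: "'a::real_inner \<times> 'a \<Rightarrow> (real \<times> real \<Rightarrow> complex) \<Rightarrow> ('a fock \<Rightarrow> 'a fock) \<Rightarrow> bool" where
  "is_O h \<phi> M \<longleftrightarrow> bounded_clinear M \<and>
     (\<forall>k\<^sub>1 k\<^sub>2. \<exists>I. cinner (exp_vec k\<^sub>1) (M (exp_vec k\<^sub>2)) = complex_of_real (1 / (2 * pi)) * I \<and>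
        pairing_inv_fourier \<phi>
          (\<lambda>(u, v). cinner (exp_vec k\<^sub>1) (U_op (u *\<^sub>R fst h) (v *\<^sub>R snd h) (exp_vec k\<^sub>2))) I)"

definition Dom_O :: "'a::real_inner \<times> 'a \<Rightarrow> (real \<times> real \<Rightarrow> complex) set" where
  "Dom_O h = {\<phi>. \<exists>M. is_O h \<phi> M}"

primrec iterated_partial ::
    "(real \<times> real) list \<Rightarrow> (real \<times> real \<Rightarrow> complex) \<Rightarrow> real \<times> real \<Rightarrow> complex" where
  "iterated_partial [] \<phi> = \<phi>"
| "iterated_partial (e # es) \<phi> =
     (\<lambda>z. vector_derivative (\<lambda>t. iterated_partial es \<phi> (z + t *\<^sub>R e)) (at 0))"

(* the elements of Basis are the two unit coordinate vectors *)
definition smooth :: "(real \<times> real \<Rightarrow> complex) \<Rightarrow> bool" where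
  "smooth \<phi> \<longleftrightarrow> (\<forall>es\<in>lists Basis. iterated_partial es \<phi> differentiable_on UNIV)"

inductive_set Smooth_ops :: "('a::real_inner fock \<Rightarrow> 'a fock) set" where
  gen: "\<lbrakk>smooth \<phi>; \<forall>es\<in>lists Basis. iterated_partial es \<phi> \<in> Dom_O h; is_O h \<phi> M\<rbrakk>
     \<Longrightarrow> M \<in> Smooth_ops"
| add: "\<lbrakk>F \<in> Smooth_ops; G \<in> Smooth_ops\<rbrakk> \<Longrightarrow> (\<lambda>\<psi>. F \<psi> + G \<psi>) \<in> Smooth_ops"
| scale: "F \<in> Smooth_ops \<Longrightarrow> (\<lambda>\<psi>. c *\<^sub>C F \<psi>) \<in> Smooth_ops"
| mult: "\<lbrakk>F \<in> Smooth_ops; G \<in> Smooth_ops\<rbrakk> \<Longrightarrow> (\<lambda>\<psi>. F (G \<psi>)) \<in> Smooth_ops"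


section \<open>Derivation and divergence\<close>

(* is_D k F G: the commutator (i/2) [Q(k1) - P(k2), F] defines the bounded operator G *)
definition is_D ::
    "'a::real_inner cpx \<times> 'a cpx \<Rightarrow> ('a fock \<Rightarrow> 'a fock) \<Rightarrow> ('a fock \<Rightarrow> 'a fock) \<Rightarrow> bool" where
  "is_D k F G \<longleftrightarrow>
     (let X = (\<lambda>\<psi>. (\<i> / 2) *\<^sub>C (Q_op (fst k) \<psi> - P_op (snd k) \<psi>))
      in defines_bounded [(X, F, id), (id, F, \<lambda>\<psi>. - X \<psi>)] G)"

definition tensor_h :: "'h::complex_inner \<Rightarrow> 'a::real_inner cpx \<Rightarrow> ('h, 'a) htensor" where
  "tensor_h \<psi> k = Abs_htensor (\<lambda>b. if b \<in> onb then inner_h (of_h b) k *\<^sub>C \<psi> else 0)"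

(* H (x) h_C (x) C^2 as the direct sum of two copies of H (x) h_C *)
type_synonym 'a fock_tensor = "('a fock, 'a) htensor \<times> ('a fock, 'a) htensor"

definition tensor_op ::
    "('a::real_inner fock \<Rightarrow> 'a fock) \<Rightarrow> 'a cpx \<times> 'a cpx \<Rightarrow> 'a fock \<Rightarrow> 'a fock_tensor" where
  "tensor_op F h \<psi> = (tensor_h (F \<psi>) (fst h), tensor_h (F \<psi>) (snd h))"

definition sum_tensor_ops ::
    "(('a::real_inner fock \<Rightarrow> 'a fock) \<times> 'a cpx \<times> 'a cpx) list \<Rightarrow> 'a fock \<Rightarrow> 'a fock_tensor" where
  "sum_tensor_ops Fs \<psi> = (\<Sum>(F, h)\<leftarrow>Fs. tensor_op F h \<psi>)"

definition S_h :: "('a::real_inner fock \<Rightarrow> 'a fock_tensor) set" where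
  "S_h = {sum_tensor_ops Fs | Fs. fst ` set Fs \<subseteq> Smooth_ops}"

text \<open>
  \<open>is_divergence u d\<close>: for a representation \<open>u = \<Sum>\<^sub>j F\<^sub>j \<otimes> h\<^sub>j\<close> with \<open>D F\<^sub>j\<close> the derivative of \<open>F\<^sub>j\<close> in direction
  \<open>h\<^sub>j\<close>, the expression for the divergence defines the bounded operator \<open>d\<close>.  Its matrix elements
  between exponential vectors do not depend on the representation.
\<close>

definition divergence_terms ::
    "('a::real_inner fock \<Rightarrow> 'a fock) \<times> ('a cpx \<times> 'a cpx) \<Rightarrow> ('a fock \<Rightarrow> 'a fock) \<Rightarrow> 'a formal_op" where
  "divergence_terms Fh G =
     (let F = fst Fh; h = snd Fh;
          X = (\<lambda>\<psi>. (1 / 2) *\<^sub>C (P_op (fst h) \<psi> + Q_op (snd h) \<psi>))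
      in [(X, F, id), (id, F, X), (id, \<lambda>\<psi>. - G \<psi>, id)])"

definition is_divergence ::
    "('a::real_inner fock \<Rightarrow> 'a fock_tensor) \<Rightarrow> ('a fock \<Rightarrow> 'a fock) \<Rightarrow> bool" where
  "is_divergence u d \<longleftrightarrow>
     (\<exists>Fs Gs. fst ` set Fs \<subseteq> Smooth_ops \<and> u = sum_tensor_ops Fs \<and>
        list_all2 (\<lambda>(F, h) G. is_D h F G) Fs Gs \<and>
        defines_bounded (concat (map2 divergence_terms Fs Gs)) d)"

definition S_h_delta :: "('a::real_inner fock \<Rightarrow> 'a fock_tensor) set" where
  "S_h_delta = {u \<in> S_h. \<exists>d. is_divergence u d}"

definition divergence :: "('a::real_inner fock \<Rightarrow> 'a fock_tensor) \<Rightarrow> 'a fock \<Rightarrow> 'a fock" where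
  "divergence u = (THE d. is_divergence u d)"

end

theory Submission
  imports Defs
begin

text \<open>
  On exponential vectors the terms of \<open>\<delta>(F \<otimes> h)\<close> combine so that only \<open>a\<^sup>+(h\<^sub>2 - i h\<^sub>1) F\<close> and
  \<open>F a(k)\<close> with \<open>k\<close> the conjugate of \<open>h\<^sub>2 + i h\<^sub>1\<close> survive.  Hence
  \<open>\<langle>\<E>(f), \<delta>(u) \<E>(g)\<rangle> = \<langle>\<E>(f) \<otimes> w, u \<E>(g)\<rangle>\<close> for a fixed vector \<open>w\<close> that depends only on \<open>f\<close> and \<open>g\<close>.
  So \<open>\<delta>(u)\<close> does not depend on the representation of \<open>u\<close>, and the matrix elements of the weak limit
  vanish between exponential vectors, which are total.
\<close>

section \<open>Orthonormal bases\<close>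

text \<open>Let A and C be the annihilation and creation parts of (P(h_1) + Q(h_2)) / 2. The
  operator whose commutator gives D_h is A - C, so subtracting D_h F from the anticommutator cancels
  A F and F C and leaves 2 C F + 2 F A. The cancelled terms are the harmful ones: A moved to the
  left creates a particle in \<E>(f), and C on the right creates one in \<E>(g), so h would sit
  inside the vectors of the matrix element. In the remaining terms both outer operators meet
  eigenvectors, and h enters only through scalars linear in h, that is, through inner products with
  a fixed element. Most of the work gives content to the encoded objects: the basis is a choice,
  exponential vectors are limits, adjoints and the divergence are definite descriptions. Explicit
  coefficients settle existence, totality settles uniqueness.\<close>

lemma orthonormal_finite_projection_orthogonal:
  fixes x :: "'a::real_inner"
  assumes "finite A" "pairwise orthogonal A" "\<forall>b\<in>A. norm b = 1" "c \<in> A"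
  shows "inner c (x - (\<Sum>b\<in>A. inner b x *\<^sub>R b)) = 0"
proof -
  have "(\<Sum>b\<in>A. inner b x * inner c b) = (\<Sum>b\<in>A. if b = c then inner c x else 0)"
    using assms by (intro sum.cong refl) (auto simp: pairwise_def orthogonal_def norm_eq_1)
  also have "\<dots> = inner c x" using assms by simp
  finally show ?thesis by (simp add: inner_diff_right inner_sum_right)
qed

text \<open>One Gram-Schmidt step: the residual of \<open>x\<close> after projection to the span of
  \<open>A\<close> is normalised and adjoined unless it vanishes.\<close>

lemma orthonormal_extend_span:
  fixes x :: "'a::real_inner"
  assumes "finite A" "pairwise orthogonal A" "\<forall>b\<in>A. norm b = 1"
  obtains A' where "finite A'" "pairwise orthogonal A'" "\<forall>b\<in>A'. norm b = 1" "A \<subseteq> A'" "x \<in> span A'"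
proof (cases "x - (\<Sum>b\<in>A. inner b x *\<^sub>R b) = 0")
  case True
  then have "x = (\<Sum>b\<in>A. inner b x *\<^sub>R b)" by simp
  moreover have "(\<Sum>b\<in>A. inner b x *\<^sub>R b) \<in> span A" by (intro span_sum span_scale span_base)
  ultimately have "x \<in> span A" by metis
  then show ?thesis using that[of A] assms by blast
next
  case False
  define r where "r = x - (\<Sum>b\<in>A. inner b x *\<^sub>R b)"
  define e where "e = (1 / norm r) *\<^sub>R r"
  have r: "r \<noteq> 0" using False by (simp add: r_def)
  have e: "inner c e = 0" if "c \<in> A" for c
    using orthonormal_finite_projection_orthogonal[OF assms that, of x] by (simp add: e_def flip: r_def)
  have "x = norm r *\<^sub>R e + (\<Sum>b\<in>A. inner b x *\<^sub>R b)"
    using r by (simp add: e_def) (simp add: r_def)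
  moreover have "norm r *\<^sub>R e + (\<Sum>b\<in>A. inner b x *\<^sub>R b) \<in> span (insert e A)"
    by (intro span_add span_scale span_sum span_base) auto
  ultimately have "x \<in> span (insert e A)" by metis
  moreover have "pairwise orthogonal (insert e A)"
    using assms(2) e by (auto simp: pairwise_insert orthogonal_def inner_commute)
  moreover have "norm e = 1" using r by (simp add: e_def)
  ultimately show ?thesis using that[of "insert e A"] assms by auto
qed

text \<open>Gram-Schmidt along a dense sequence gives an increasing chain of finite orthonormal
  sets; two vectors of the union already lie in a common member. Existence is what makes the choice
  \<open>onb\<close> usable.\<close>

lemma orthonormal_basis_exists:
  "\<exists>B :: 'a::{real_inner, polish_space} set. orthonormal_basis B"
proof -
  obtain D :: "'a set" where D: "countable D" "\<And>X. open X \<Longrightarrow> X \<noteq> {} \<Longrightarrow> \<exists>d\<in>D. d \<in> X"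
    using countable_dense_exists by blast
  have "D \<noteq> {}" using D(2)[of UNIV] by auto
  then obtain x where x: "D = range (x :: nat \<Rightarrow> 'a)" using D(1) by (metis uncountable_def)
  define ok where "ok = (\<lambda>A :: 'a set. finite A \<and> pairwise orthogonal A \<and> (\<forall>b\<in>A. norm b = 1))"
  have "\<exists>\<B>. \<forall>n. ok (\<B> n) \<and> \<B> n \<subseteq> \<B> (Suc n) \<and> x n \<in> span (\<B> (Suc n))"
  proof (rule dependent_nat_choice)
    show "\<exists>A. ok A" by (rule exI[of _ "{}"]) (simp add: ok_def)
    show "\<exists>A'. ok A' \<and> A \<subseteq> A' \<and> x n \<in> span A'" if "ok A" for A n
      using that orthonormal_extend_span[of A "x n"] unfolding ok_def by metis
  qed
  then obtain \<B> where \<B>: "\<And>n. ok (\<B> n)" "\<And>n. \<B> n \<subseteq> \<B> (Suc n)" "\<And>n. x n \<in> span (\<B> (Suc n))"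
    by blast
  define B where "B = (\<Union>n. \<B> n)"
  have mono: "\<B> m \<subseteq> \<B> n" if "m \<le> n" for m n
    using that \<B>(2) by (rule lift_Suc_mono_le[rotated])
  have "pairwise orthogonal B"
  proof (rule pairwiseI)
    fix a b assume "a \<in> B" "b \<in> B" "a \<noteq> b"
    then obtain m n where "a \<in> \<B> m" "b \<in> \<B> n" by (auto simp: B_def)
    then have "a \<in> \<B> (max m n)" "b \<in> \<B> (max m n)"
      using mono[of m "max m n"] mono[of n "max m n"] by auto
    then show "orthogonal a b" using \<B>(1)[of "max m n"] \<open>a \<noteq> b\<close> by (auto simp: ok_def pairwise_def)
  qed
  moreover have "\<forall>b\<in>B. norm b = 1" using \<B>(1) by (auto simp: B_def ok_def)
  moreover have "closure (span B) = UNIV"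
  proof -
    have "range x \<subseteq> span B"
      using \<B>(3) span_mono[of "\<B> (Suc _)" B] by (force simp: B_def)
    moreover have "y \<in> closure (range x)" for y
      unfolding closure_approachable
    proof (intro allI impI)
      fix e :: real assume "e > 0"
      then show "\<exists>z\<in>range x. dist z y < e"
        using D(2)[of "ball y e"] x by (auto simp: dist_commute)
    qed
    ultimately show ?thesis using closure_mono by blast
  qed
  ultimately show ?thesis by (auto simp: orthonormal_basis_def)
qed

lemma orthonormal_basis_onb: "orthonormal_basis (onb :: 'a::{real_inner, polish_space} set)"
  unfolding onb_def by (rule someI_ex[OF orthonormal_basis_exists])

lemma inner_onb:
  assumes "b \<in> (onb :: 'a::{real_inner, polish_space} set)" "c \<in> onb"
  shows "inner b c = (if b = c then 1 else 0)"
  using orthonormal_basis_onb[where 'a = 'a] assms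
  by (auto simp: orthonormal_basis_def pairwise_def orthogonal_def norm_eq_1)

text \<open>Best approximation: some finite combination over \<open>A\<close> is within
  \<open>e\<close> of \<open>x\<close>, and for each finite \<open>Y\<close> containing
  \<open>A\<close> the projection of \<open>x\<close> to the span of \<open>Y\<close> is at least as
  close.\<close>

lemma has_sum_onb_expansion:
  fixes x :: "'a::{real_inner, polish_space}"
  shows "((\<lambda>b. inner b x *\<^sub>R b) has_sum x) onb"
  unfolding has_sum_def tendsto_iff eventually_finite_subsets_at_top
proof (intro allI impI)
  fix e :: real assume "e > 0"
  have o: "pairwise orthogonal (onb :: 'a set)" "\<forall>b\<in>onb. norm (b :: 'a) = 1"
    "x \<in> closure (span onb)"
    using orthonormal_basis_onb[where 'a = 'a] by (auto simp: orthonormal_basis_def)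
  then obtain z where z: "z \<in> span onb" "dist z x < e"
    using \<open>e > 0\<close> unfolding closure_approachable by blast
  then obtain A r where A: "finite A" "A \<subseteq> onb" "z = (\<Sum>b\<in>A. r b *\<^sub>R b)"
    unfolding span_explicit by blast
  show "\<exists>X. finite X \<and> X \<subseteq> onb \<and> (\<forall>Y. finite Y \<and> X \<subseteq> Y \<and> Y \<subseteq> onb \<longrightarrow>
      dist (\<Sum>b\<in>Y. inner b x *\<^sub>R b) x < e)"
  proof (intro exI[of _ A] conjI allI impI A)
    fix Y assume Y: "finite Y \<and> A \<subseteq> Y \<and> Y \<subseteq> (onb :: 'a set)"
    define p where "p = (\<Sum>b\<in>Y. inner b x *\<^sub>R b)"
    have "inner c (x - p) = 0" if "c \<in> Y" for c
      unfolding p_def using Y o that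
      by (intro orthonormal_finite_projection_orthogonal) (auto intro: pairwise_subset)
    then have "orthogonal (x - p) c" if "c \<in> span Y" for c
      by (intro orthogonal_to_span[OF that]) (simp add: orthogonal_def inner_commute)
    moreover have "p - z \<in> span Y"
      unfolding p_def A(3) using Y by (intro span_diff span_sum span_scale span_base) auto
    ultimately have "(norm (x - p + (p - z)))\<^sup>2 = (norm (x - p))\<^sup>2 + (norm (p - z))\<^sup>2"
      by (intro norm_add_Pythagorean) blast
    then have "(norm (x - p))\<^sup>2 \<le> (norm (x - z))\<^sup>2" by simp
    then have "norm (x - p) \<le> norm (x - z)" by (simp add: power_mono_iff)
    then show "dist (\<Sum>b\<in>Y. inner b x *\<^sub>R b) x < e"
      using z(2) by (simp add: dist_norm norm_minus_commute flip: p_def)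
  qed
qed

section \<open>Parseval's identity in the real space and in its complexification\<close>

lemma has_sum_parseval:
  fixes x y :: "'a::{real_inner, polish_space}"
  shows "((\<lambda>b. inner x b * inner b y) has_sum inner x y) onb"
  using has_sum_bounded_linear[OF bounded_linear_inner_right has_sum_onb_expansion, of x y]
  by (simp add: mult.commute)

lemma inner_h_commute: "inner_h k l = cnj (inner_h l k)"
  by (simp add: inner_h_def complex_eq_iff inner_commute)

lemma has_sum_parseval_inner_h:
  fixes k l :: "'a::{real_inner, polish_space} cpx"
  shows "((\<lambda>b. inner_h k (of_h b) * inner_h (of_h b) l) has_sum inner_h k l) onb"
proof -
  let ?r = "\<lambda>x y. complex_of_real (inner x y)"
  \<comment> \<open>Splitting into real inner products reduces the complex identity to four real
    Parseval sums.\<close>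
  have eq: "inner_h p q = ?r (fst p) (fst q) + ?r (snd p) (snd q) + \<i> * ?r (fst p) (snd q) + - \<i> * ?r (snd p) (fst q)"
    for p q :: "'a cpx" by (simp add: inner_h_def complex_eq_iff)
  have "((\<lambda>b. complex_of_real (inner (fst k) b * inner b (fst l)) + complex_of_real (inner (snd k) b * inner b (snd l)) +
      \<i> * complex_of_real (inner (fst k) b * inner b (snd l)) + - \<i> * complex_of_real (inner (snd k) b * inner b (fst l)))
      has_sum inner_h k l) onb"
    unfolding eq
    by (intro has_sum_add has_sum_of_real has_sum_cmult_right has_sum_parseval)
  then show ?thesis
    by (rule has_sum_cong[THEN iffD1, rotated]) (simp add: inner_h_def of_h_def complex_eq_iff algebra_simps)
qed

section \<open>Sums over lists\<close>

lemma has_sum_imp_norm_summable_complex: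
  "(f has_sum s) A \<Longrightarrow> (\<lambda>x. cmod (f x)) summable_on A"
  by (rule summable_on_iff_abs_summable_on_complex[THEN iffD1, OF has_sum_imp_summable])

lemma abs_summable_on_times:
  fixes f g :: "_ \<Rightarrow> 'c::real_normed_div_algebra"
  assumes "(\<lambda>x. norm (f x)) summable_on A" "(\<lambda>y. norm (g y)) summable_on B"
  shows "(\<lambda>(x, y). norm (f x * g y)) summable_on A \<times> B"
proof (rule summable_on_SigmaI)
  show "((\<lambda>y. case (x, y) of (x, y) \<Rightarrow> norm (f x * g y)) has_sum norm (f x) * (\<Sum>\<^sub>\<infinity>y\<in>B. norm (g y))) B" for x
    using has_sum_cmult_right[OF has_sum_infsum[OF assms(2)], of "norm (f x)"] by (simp add: norm_mult)
  show "(\<lambda>x. norm (f x) * (\<Sum>\<^sub>\<infinity>y\<in>B. norm (g y))) summable_on A"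
    by (rule summable_on_cmult_left[OF assms(1)])
qed auto

lemma has_sum_times:
  fixes f g :: "_ \<Rightarrow> 'c::{real_normed_field, banach}"
  assumes f: "(f has_sum a) A" "(\<lambda>x. norm (f x)) summable_on A"
    and g: "(g has_sum b) B" "(\<lambda>y. norm (g y)) summable_on B"
  shows "((\<lambda>(x, y). f x * g y) has_sum a * b) (A \<times> B)"
proof (rule has_sum_SigmaI)
  show "((\<lambda>y. case (x, y) of (x, y) \<Rightarrow> f x * g y) has_sum f x * b) B" for x
    using has_sum_cmult_right[OF g(1), of "f x"] by simp
  show "((\<lambda>x. f x * b) has_sum a * b) A" by (rule has_sum_cmult_left[OF f(1)])
  show "(\<lambda>(x, y). f x * g y) summable_on A \<times> B"
    using abs_summable_on_times[OF f(2) g(2)]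
    by (rule abs_summable_summable[OF back_subst[of "\<lambda>h. h summable_on _"]]) (simp add: case_prod_unfold)
qed

text \<open>Lists of length \<open>n\<close> over an orthonormal basis label the product basis of
  the \<open>n\<close>-fold tensor power.\<close>

definition lists_length :: "'b set \<Rightarrow> nat \<Rightarrow> 'b list set" where
  "lists_length B n = {bs. set bs \<subseteq> B \<and> length bs = n}"

lemma lists_length_0: "lists_length B 0 = {[]}"
  by (auto simp: lists_length_def)

lemma bij_betw_Cons: "bij_betw (\<lambda>(b, bs). b # bs) (B \<times> lists_length B n) (lists_length B (Suc n))"
proof (rule bij_betw_byWitness[where f' = "\<lambda>bs. (hd bs, tl bs)"])
  show "\<forall>bs\<in>lists_length B (Suc n). (case (hd bs, tl bs) of (b, bs) \<Rightarrow> b # bs) = bs"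
    by (auto simp: lists_length_def length_Suc_conv)
  show "(\<lambda>bs. (hd bs, tl bs)) ` lists_length B (Suc n) \<subseteq> B \<times> lists_length B n"
    by (auto simp: lists_length_def length_Suc_conv)
qed (auto simp: lists_length_def)

lemma has_sum_lists_length_Suc:
  fixes f :: "_ \<Rightarrow> 'c::{real_normed_field, banach}"
  assumes "(f has_sum a) B" "(\<lambda>x. norm (f x)) summable_on B"
    and "(g has_sum s) (lists_length B n)" "(\<lambda>bs. norm (g bs)) summable_on lists_length B n"
  shows "((\<lambda>bs. f (hd bs) * g (tl bs)) has_sum a * s) (lists_length B (Suc n))"
    and "(\<lambda>bs. norm (f (hd bs) * g (tl bs))) summable_on lists_length B (Suc n)"
proof -
  let ?h = "\<lambda>bs. f (hd bs) * g (tl bs)"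
  have "((\<lambda>p. ?h (case p of (b, bs) \<Rightarrow> b # bs)) has_sum a * s) (B \<times> lists_length B n)"
    using has_sum_times[OF assms] by (simp add: case_prod_unfold)
  then show "(?h has_sum a * s) (lists_length B (Suc n))"
    unfolding has_sum_reindex_bij_betw[OF bij_betw_Cons, where f = ?h] .
  have "(\<lambda>p. norm (?h (case p of (b, bs) \<Rightarrow> b # bs))) summable_on (B \<times> lists_length B n)"
    using abs_summable_on_times[OF assms(2,4)] by (simp add: case_prod_unfold)
  then show "(\<lambda>bs. norm (?h bs)) summable_on lists_length B (Suc n)"
    unfolding summable_on_reindex_bij_betw[OF bij_betw_Cons, where f = "\<lambda>bs. norm (?h bs)"] .
qed

text \<open>Expansion of the \<open>n\<close>-th power of a sum. Absolute summability is carried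
  along because multiplying two sums in the induction step uses it.\<close>

lemma has_sum_prod_lists_length:
  fixes f :: "_ \<Rightarrow> 'c::{real_normed_field, banach}"
  assumes "(f has_sum s) B" "(\<lambda>x. norm (f x)) summable_on B"
  shows "((\<lambda>bs. \<Prod>b\<leftarrow>bs. f b) has_sum s ^ n) (lists_length B n)"
    and "(\<lambda>bs. norm (\<Prod>b\<leftarrow>bs. f b)) summable_on lists_length B n"
proof -
  have "((\<lambda>bs. \<Prod>b\<leftarrow>bs. f b) has_sum s ^ n) (lists_length B n) \<and>
     (\<lambda>bs. norm (\<Prod>b\<leftarrow>bs. f b)) summable_on lists_length B n"
  proof (induction n)
    case (Suc n)
    have eq: "(\<Prod>b\<leftarrow>bs. f b) = f (hd bs) * (\<Prod>b\<leftarrow>tl bs. f b)" if "bs \<in> lists_length B (Suc n)" for bs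
      using that by (cases bs) (auto simp: lists_length_def)
    note h = has_sum_lists_length_Suc[OF assms conjunct1[OF Suc] conjunct2[OF Suc]]
    show ?case
      unfolding power_Suc
      by (intro conjI has_sum_cong[OF eq, THEN iffD2, OF _ h(1)] summable_on_cong[THEN iffD2, OF _ h(2)])
        (simp_all only: eq)
  qed (simp add: lists_length_0 has_sum_finite_iff)
  then show "((\<lambda>bs. \<Prod>b\<leftarrow>bs. f b) has_sum s ^ n) (lists_length B n)"
    "(\<lambda>bs. norm (\<Prod>b\<leftarrow>bs. f b)) summable_on lists_length B n" by auto
qed

text \<open>The derivative of \<open>\<Prod>b\<leftarrow>bs. f b\<close> when the derivative of \<open>f b\<close> is \<open>d b\<close>.\<close>

primrec leibniz :: "('b \<Rightarrow> complex) \<Rightarrow> ('b \<Rightarrow> complex) \<Rightarrow> 'b list \<Rightarrow> complex" where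
  "leibniz d f [] = 0"
| "leibniz d f (b # bs) = d b * (\<Prod>c\<leftarrow>bs. f c) + f b * leibniz d f bs"

text \<open>The sum over deleted positions is the shape in which \<open>creat\<close> is
  defined.\<close>

lemma leibniz_eq_sum:
  "leibniz d f bs = (\<Sum>j<length bs. d (bs ! j) * (\<Prod>c\<leftarrow>take j bs @ drop (Suc j) bs. f c))"
  by (induction bs) (simp_all add: sum.lessThan_Suc_shift sum_distrib_left algebra_simps del: sum.lessThan_Suc)

text \<open>Passing to the multiset of entries exposes the symmetry that membership in
  \<open>fock_functions\<close> asks for.\<close>

lemma leibniz_eq_sum_mset:
  "leibniz d f bs = (\<Sum>b\<in>#mset bs. d b * (\<Prod>c\<in>#mset bs - {#b#}. f c))"
proof (induction bs)
  case (Cons b bs)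
  have "(\<Sum>x\<in>#mset bs. d x * (\<Prod>c\<in>#add_mset b (mset bs) - {#x#}. f c)) =
      (\<Sum>x\<in>#mset bs. f b * (d x * (\<Prod>c\<in>#mset bs - {#x#}. f c)))"
    by (intro arg_cong[where f = sum_mset] image_mset_cong) (auto simp: algebra_simps)
  also have "\<dots> = f b * leibniz d f bs" by (simp add: Cons sum_mset_distrib_left)
  finally show ?case by (simp flip: prod_mset_prod_list)
qed simp

lemma leibniz_perm: "mset bs = mset cs \<Longrightarrow> leibniz d f bs = leibniz d f cs"
  by (simp add: leibniz_eq_sum_mset)

lemma leibniz_mult: "(\<Prod>b\<leftarrow>bs. g b) * leibniz d f bs = leibniz (\<lambda>b. g b * d b) (\<lambda>b. g b * f b) bs"
proof (induction bs)
  case (Cons b bs)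
  have "(\<Prod>c\<leftarrow>bs. g c * f c) = (\<Prod>c\<leftarrow>bs. g c) * (\<Prod>c\<leftarrow>bs. f c)"
    by (induction bs) (simp_all add: algebra_simps)
  with Cons show ?case by (simp only: leibniz.simps list.map prod_list.Cons) (simp add: algebra_simps)
qed simp

lemma prod_list_map_nonneg: "(\<And>b. 0 \<le> f b) \<Longrightarrow> (0::real) \<le> (\<Prod>b\<leftarrow>bs. f b)"
  by (induction bs) auto

text \<open>In the expansion of the right-hand product, the terms with exactly one factor from
  \<open>d\<close> and the term with none dominate the two summands. Bounding their sum, not the
  derivative alone, lets the induction close.\<close>

lemma norm_leibniz_le: "cmod (leibniz d f bs) + cmod (\<Prod>b\<leftarrow>bs. f b) \<le> (\<Prod>b\<leftarrow>bs. cmod (d b) + cmod (f b))"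
proof (induction bs)
  case (Cons b bs)
  have "cmod (leibniz d f (b # bs)) \<le> cmod (d b) * cmod (\<Prod>b\<leftarrow>bs. f b) + cmod (f b) * cmod (leibniz d f bs)"
    using norm_triangle_ineq[of "d b * (\<Prod>c\<leftarrow>bs. f c)" "f b * leibniz d f bs"] by (simp add: norm_mult)
  then have "cmod (leibniz d f (b # bs)) + cmod (\<Prod>b\<leftarrow>b # bs. f b) \<le>
      (cmod (d b) + cmod (f b)) * (cmod (leibniz d f bs) + cmod (\<Prod>b\<leftarrow>bs. f b))"
    using mult_nonneg_nonneg[OF norm_ge_zero norm_ge_zero, of "d b" "leibniz d f bs"]
    unfolding list.map prod_list.Cons norm_mult distrib_right distrib_left by linarith
  also have "\<dots> \<le> (cmod (d b) + cmod (f b)) * (\<Prod>b\<leftarrow>bs. cmod (d b) + cmod (f b))"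
    by (intro mult_left_mono Cons) auto
  finally show ?case by simp
qed simp

text \<open>The value is the derivative of \<open>s ^ n\<close> in direction \<open>a\<close>. At
  \<open>n = 0\<close> the factor \<open>of_nat n\<close> makes the truncated exponent
  \<open>n - 1\<close> harmless.\<close>

lemma has_sum_leibniz_lists_length:
  assumes "(d has_sum a) B" "(f has_sum s) B"
  shows "(leibniz d f has_sum of_nat n * a * s ^ (n - 1)) (lists_length B n)"
proof (induction n)
  case (Suc n)
  note abs = has_sum_imp_norm_summable_complex
  note f = has_sum_prod_lists_length(1)[OF assms(2) abs[OF assms(2)], of n]
  have h: "((\<lambda>bs. d (hd bs) * (\<Prod>b\<leftarrow>tl bs. f b) + f (hd bs) * leibniz d f (tl bs)) has_sum
      a * s ^ n + s * (of_nat n * a * s ^ (n - 1))) (lists_length B (Suc n))"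
    by (intro has_sum_add has_sum_lists_length_Suc(1)) (use assms Suc f abs in blast)+
  have e: "leibniz d f bs = d (hd bs) * (\<Prod>b\<leftarrow>tl bs. f b) + f (hd bs) * leibniz d f (tl bs)"
    if "bs \<in> lists_length B (Suc n)" for bs
    using that by (cases bs) (auto simp: lists_length_def)
  have v: "a * s ^ n + s * (of_nat n * a * s ^ (n - 1)) = of_nat (Suc n) * a * s ^ n"
    by (cases n) (simp_all add: algebra_simps)
  show ?case
    unfolding diff_Suc_1 v[symmetric] by (rule has_sum_cong[OF e, THEN iffD2, OF _ h])
qed (simp add: lists_length_0 has_sum_finite_iff)

lemma bij_betw_lists_Sigma: "bij_betw snd (SIGMA n:UNIV. lists_length B n) {bs. set bs \<subseteq> B}"
  by (rule bij_betw_byWitness[where f' = "\<lambda>bs. (length bs, bs)"]) (auto simp: lists_length_def)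

text \<open>Grouped by length, the sum becomes the exponential series of the sum of
  \<open>f\<close>. This is the source of square summability for exponential vectors.\<close>

lemma summable_on_lists_fact:
  fixes f :: "'b \<Rightarrow> real"
  assumes "f summable_on B" "\<And>b. 0 \<le> f b"
  shows "(\<lambda>bs. (\<Prod>b\<leftarrow>bs. f b) / fact (length bs)) summable_on {bs. set bs \<subseteq> B}"
proof -
  obtain s where s: "(f has_sum s) B" using assms(1) by (auto simp: summable_on_def)
  have "(\<lambda>(n, bs). (\<Prod>b\<leftarrow>bs. f b) / fact (length bs)) summable_on (SIGMA n:UNIV. lists_length B n)"
  proof (rule summable_on_SigmaI)
    fix n :: nat
    have "((\<lambda>bs. (\<Prod>b\<leftarrow>bs. f b) / fact n) has_sum s ^ n / fact n) (lists_length B n)"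
      using has_sum_prod_lists_length(1)[OF s, of n] assms
      by (intro has_sum_divide_const) auto
    then show "((\<lambda>bs. case (n, bs) of (n, bs) \<Rightarrow> (\<Prod>b\<leftarrow>bs. f b) / fact (length bs)) has_sum s ^ n / fact n)
        (lists_length B n)"
      by (rule has_sum_cong[THEN iffD1, rotated]) (simp add: lists_length_def)
    show "(\<lambda>n. s ^ n / fact n) summable_on (UNIV :: nat set)"
      using summable_exp[of s] has_sum_nonneg[OF s] assms(2)
      by (subst summable_on_UNIV_nonneg_real_iff) (auto simp: field_simps)
  qed (auto intro!: divide_nonneg_nonneg prod_list_map_nonneg assms)
  then show ?thesis
    using summable_on_reindex_bij_betw[OF bij_betw_lists_Sigma[of B], where f = "\<lambda>bs. (\<Prod>b\<leftarrow>bs. f b) / fact (length bs)"]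
    by (simp add: case_prod_unfold)
qed

text \<open>Summability over all lists permits grouping by length, so the value can be read off the
  series of fixed-length sums.\<close>

lemma has_sum_lists_imp_sums:
  fixes F :: "'b list \<Rightarrow> complex"
  assumes "F summable_on {bs. set bs \<subseteq> B}" "\<And>n. (F has_sum s n) (lists_length B n)" "s sums t"
  shows "(F has_sum t) {bs. set bs \<subseteq> B}"
proof -
  obtain t' where t': "(F has_sum t') {bs. set bs \<subseteq> B}" using assms(1) by (auto simp: summable_on_def)
  then have "((\<lambda>(n, bs). F bs) has_sum t') (SIGMA n:UNIV. lists_length B n)"
    using has_sum_reindex_bij_betw[OF bij_betw_lists_Sigma[of B], where f = F] by (simp add: case_prod_unfold)
  then have "(s has_sum t') UNIV" by (rule has_sum_SigmaD) (simp add: assms(2))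
  then have "s sums t'" by (rule has_sum_imp_sums)
  with assms(3) t' show ?thesis using sums_unique2 by blast
qed

section \<open>Exponential vectors\<close>

lemmas fock_coeff_simps = zero_fock.rep_eq plus_fock.rep_eq minus_fock.rep_eq scaleR_fock.rep_eq
  scaleC_fock.rep_eq

lemma fock_functionsI:
  assumes "square_summable f" "\<And>bs. \<not> set bs \<subseteq> onb \<Longrightarrow> f bs = 0"
    and "\<And>bs cs. mset bs = mset cs \<Longrightarrow> f bs = f cs"
  shows "f \<in> fock_functions"
  unfolding fock_functions_def by (intro CollectI conjI allI impI assms)

lemma fock_eqI: "(\<And>bs. fock_coeff x bs = fock_coeff y bs) \<Longrightarrow> x = y"
  unfolding fock_coeff_inject[symmetric] by (rule ext)

lemma fock_coeff_outside: "\<not> set bs \<subseteq> onb \<Longrightarrow> fock_coeff \<psi> bs = 0"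
  using fock_coeff[of \<psi>] by (simp add: fock_functions_def)

lemma fock_coeff_perm: "mset bs = mset cs \<Longrightarrow> fock_coeff \<psi> bs = fock_coeff \<psi> cs"
  by (rule fock_functions_perm[OF fock_coeff])

lemma fock_coeff_to_fock: "f \<in> fock_functions \<Longrightarrow> fock_coeff (to_fock f) = f"
  by (simp add: to_fock_def Abs_fock_inverse)

lemma to_fock_fock_coeff: "to_fock (fock_coeff \<psi>) = \<psi>"
  by (simp add: to_fock_def fock_coeff fock_coeff_inverse)

lemma fock_coeff_sum: "fock_coeff (\<Sum>i\<in>A. x i) bs = (\<Sum>i\<in>A. fock_coeff (x i) bs)"
  by (induction A rule: infinite_finite_induct) (simp_all add: fock_coeff_simps)

lemma has_sum_cinner_fock:
  "((\<lambda>bs. cnj (fock_coeff x bs) * fock_coeff y bs) has_sum cinner x y) UNIV"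
  using has_sum_infsum[OF summable_cinner[of "fock_coeff x" "fock_coeff y"]] fock_coeff[of x] fock_coeff[of y]
  by (simp add: cinner_fock.rep_eq l2_cinner_def cinner_complex_def fock_functionsD)

lemma has_sum_norm_fock: "((\<lambda>bs. (cmod (fock_coeff x bs))\<^sup>2) has_sum (norm x)\<^sup>2) UNIV"
proof -
  have "((\<lambda>bs. complex_of_real ((cmod (fock_coeff x bs))\<^sup>2)) has_sum complex_of_real ((norm x)\<^sup>2)) UNIV"
    using has_sum_cinner_fock[of x x]
    by (simp add: cinner_self mult.commute[of "cnj _"] flip: complex_norm_square)
  then show ?thesis by (simp only: has_sum_of_real_iff)
qed

lemma norm_fock_le:
  assumes "\<And>bs. cmod (fock_coeff x bs) \<le> c * cmod (fock_coeff y bs)" "0 \<le> c"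
  shows "norm x \<le> c * norm y"
proof -
  have "((\<lambda>bs. c\<^sup>2 * (cmod (fock_coeff y bs))\<^sup>2) has_sum c\<^sup>2 * (norm y)\<^sup>2) UNIV"
    by (rule has_sum_cmult_right[OF has_sum_norm_fock])
  then have "(norm x)\<^sup>2 \<le> c\<^sup>2 * (norm y)\<^sup>2"
    by (rule has_sum_mono[OF has_sum_norm_fock]) (use assms in \<open>simp add: power_mono flip: power_mult_distrib\<close>)
  then show ?thesis
    using assms(2) by (simp flip: power_mult_distrib add: power2_le_iff_abs_le)
qed

text \<open>The orthogonal projection that keeps the coefficients with occupation numbers in
  \<open>A\<close>. Selecting by multisets and not by lists keeps the result symmetric.\<close>

lift_definition restr :: "'a::real_inner multiset set \<Rightarrow> 'a fock \<Rightarrow> 'a fock"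
  is "\<lambda>A f bs. if mset bs \<in> A then f bs else 0"
proof -
  fix A and f :: "'a list \<Rightarrow> complex" assume f: "f \<in> fock_functions"
  have "square_summable (\<lambda>bs. if mset bs \<in> A then f bs else 0)"
    unfolding square_summable_def
    by (rule summable_on_comparison_test[of "\<lambda>bs. (cmod (f bs))\<^sup>2"])
      (use fock_functionsD[OF f] in \<open>auto simp: square_summable_def\<close>)
  then show "(\<lambda>bs. if mset bs \<in> A then f bs else 0) \<in> fock_functions"
  proof (rule fock_functionsI)
    show "(if mset bs \<in> A then f bs else 0) = 0" if "\<not> set bs \<subseteq> onb" for bs
      using f that by (simp add: fock_functions_def)
    show "(if mset bs \<in> A then f bs else 0) = (if mset cs \<in> A then f cs else 0)"
      if "mset bs = mset cs" for bs cs
      unfolding that fock_functions_perm[OF f that] ..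
  qed
qed

lemma bounded_linear_restr: "bounded_linear (restr A)"
proof
  show "restr A (x + y) = restr A x + restr A y" for x y
    by (rule fock_eqI) (simp add: restr.rep_eq fock_coeff_simps)
  show "restr A (r *\<^sub>R x) = r *\<^sub>R restr A x" for r x
    by (rule fock_eqI) (simp add: restr.rep_eq fock_coeff_simps)
  have "norm (restr A x) \<le> norm x * 1" for x
    using norm_fock_le[of "restr A x" 1 x] by (simp add: restr.rep_eq)
  then show "\<exists>K. \<forall>x. norm (restr A x) \<le> norm x * K" by blast
qed

lemma restr_scaleC: "restr A (c *\<^sub>C x) = c *\<^sub>C restr A x"
  by (rule fock_eqI) (simp add: restr.rep_eq fock_coeff_simps scaleC_zero)

lemma restr_tendsto:
  assumes "\<And>m. eventually (\<lambda>i. m \<in> A i) F"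
  shows "((\<lambda>i. restr (A i) \<psi>) \<longlongrightarrow> \<psi>) F"
  unfolding tendsto_iff
proof (intro allI impI)
  fix e :: real assume "e > 0"
  let ?c = "\<lambda>bs. (cmod (fock_coeff \<psi> bs))\<^sup>2"
  have "\<forall>\<^sub>F X in finite_subsets_at_top UNIV. dist (sum ?c X) ((norm \<psi>)\<^sup>2) < e\<^sup>2"
    using has_sum_norm_fock[of \<psi>] \<open>e > 0\<close> unfolding has_sum_def tendsto_iff by simp
  then obtain X where X: "finite X" "dist (sum ?c X) ((norm \<psi>)\<^sup>2) < e\<^sup>2"
    unfolding eventually_finite_subsets_at_top by blast
  have "\<forall>\<^sub>F i in F. \<forall>m\<in>mset ` X. m \<in> A i"
    using X(1) assms by (intro eventually_ball_finite) auto
  then show "\<forall>\<^sub>F i in F. dist (restr (A i) \<psi>) \<psi> < e"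
  proof eventually_elim
    case (elim i)
    \<comment> \<open>The two summands are never both nonzero: on \<open>X\<close> the projection
      keeps the coefficient, so the difference vanishes there. Hence the error is at most the tail
      of the norm outside \<open>X\<close>.\<close>
    have "((\<lambda>bs. (cmod (fock_coeff (\<psi> - restr (A i) \<psi>) bs))\<^sup>2 + (if bs \<in> X then ?c bs else 0)) has_sum
        (norm (\<psi> - restr (A i) \<psi>))\<^sup>2 + sum ?c X) UNIV"
      using X(1) by (intro has_sum_add has_sum_norm_fock has_sum_finite_neutralI[of X]) auto
    then have "(norm (\<psi> - restr (A i) \<psi>))\<^sup>2 + sum ?c X \<le> (norm \<psi>)\<^sup>2"
      by (rule has_sum_mono[OF _ has_sum_norm_fock]) (use elim in \<open>auto simp: restr.rep_eq fock_coeff_simps\<close>)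
    then have "(norm (\<psi> - restr (A i) \<psi>))\<^sup>2 < e\<^sup>2"
      using X(2) by (simp add: dist_real_def abs_if split: if_splits)
    then show ?case
      using \<open>e > 0\<close> by (simp add: dist_norm norm_minus_commute power_less_imp_less_base)
  qed
qed

lemma summable_on_norm_inner_h:
  fixes g :: "'a::{real_inner, polish_space} cpx"
  shows "(\<lambda>b. (cmod (inner_h (of_h b) g))\<^sup>2) summable_on onb"
proof -
  have "((\<lambda>b. inner_h g (of_h b) * inner_h (of_h b) g) has_sum inner_h g g) onb"
    by (rule has_sum_parseval_inner_h)
  then have "(\<lambda>b. norm (inner_h g (of_h b) * inner_h (of_h b) g)) summable_on onb"
    by (rule has_sum_imp_norm_summable_complex)
  moreover have "norm (inner_h g (of_h b) * inner_h (of_h b) g) = (cmod (inner_h (of_h b) g))\<^sup>2" for b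
    by (subst inner_h_commute) (simp add: norm_mult power2_eq_square)
  ultimately show ?thesis by simp
qed

text \<open>Squaring removes the root from the factorial, so the squared coefficients are dominated
  by an exponential series. A bound with two vectors serves exponential vectors and their images
  under creation alike.\<close>

lemma fock_functions_over_sqrt_fact:
  fixes F :: "'a::{real_inner, polish_space} list \<Rightarrow> complex"
  assumes perm: "\<And>bs cs. mset bs = mset cs \<Longrightarrow> F bs = F cs"
    and le: "\<And>bs. cmod (F bs) \<le> (\<Prod>b\<leftarrow>bs. cmod (inner_h (of_h b) h) + cmod (inner_h (of_h b) g))"
  shows "(\<lambda>bs. if set bs \<subseteq> onb then F bs / complex_of_real (sqrt (fact (length bs))) else 0) \<in> fock_functions"
proof -
  let ?d = "\<lambda>b. cmod (inner_h (of_h b) h)" and ?f = "\<lambda>b. cmod (inner_h (of_h b) g)"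
  have "(\<lambda>b. 2 * (?d b)\<^sup>2 + 2 * (?f b)\<^sup>2) summable_on onb"
    by (intro summable_on_add summable_on_cmult_right summable_on_norm_inner_h)
  then have "(\<lambda>b. (?d b + ?f b)\<^sup>2) summable_on onb"
  proof (rule summable_on_comparison_test)
    show "(?d b + ?f b)\<^sup>2 \<le> 2 * (?d b)\<^sup>2 + 2 * (?f b)\<^sup>2" for b
      using zero_le_power2[of "?d b - ?f b"] by (simp add: power2_sum power2_diff)
  qed simp
  then have "(\<lambda>bs. (\<Prod>b\<leftarrow>bs. (?d b + ?f b)\<^sup>2) / fact (length bs)) summable_on {bs. set bs \<subseteq> onb}"
    by (rule summable_on_lists_fact) simp
  then have "(\<lambda>bs. (cmod (F bs / complex_of_real (sqrt (fact (length bs)))))\<^sup>2) summable_on {bs. set bs \<subseteq> onb}"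
  proof (rule summable_on_comparison_test)
    fix bs
    have "(cmod (F bs))\<^sup>2 \<le> (\<Prod>b\<leftarrow>bs. ?d b + ?f b)\<^sup>2" by (rule power_mono[OF le]) simp
    also have "\<dots> = (\<Prod>b\<leftarrow>bs. (?d b + ?f b)\<^sup>2)"
      by (induction bs) (simp_all add: power_mult_distrib)
    finally show "(cmod (F bs / complex_of_real (sqrt (fact (length bs)))))\<^sup>2 \<le>
        (\<Prod>b\<leftarrow>bs. (?d b + ?f b)\<^sup>2) / fact (length bs)"
      by (simp add: norm_divide power_divide divide_right_mono)
  qed simp
  then have "square_summable (\<lambda>bs. if set bs \<subseteq> onb then F bs / complex_of_real (sqrt (fact (length bs))) else 0)"
    unfolding square_summable_def
    by (rule summable_on_cong_neutral[THEN iffD1, rotated 3]) auto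
  then show ?thesis
  proof (rule fock_functionsI)
    fix bs cs :: "'a list" assume m: "mset bs = mset cs"
    show "(if set bs \<subseteq> onb then F bs / complex_of_real (sqrt (fact (length bs))) else 0) =
        (if set cs \<subseteq> onb then F cs / complex_of_real (sqrt (fact (length cs))) else 0)"
      unfolding perm[OF m] mset_eq_setD[OF m] mset_eq_length[OF m] ..
  qed simp
qed

lemma exp_vec_coeff_in_fock_functions:
  fixes g :: "'a::{real_inner, polish_space} cpx"
  shows "(\<lambda>bs. if set bs \<subseteq> onb then (\<Prod>b\<leftarrow>bs. inner_h (of_h b) g) / complex_of_real (sqrt (fact (length bs))) else 0)
    \<in> fock_functions"
proof (rule fock_functions_over_sqrt_fact[where h = g and g = g])
  show "(\<Prod>b\<leftarrow>bs. inner_h (of_h b) g) = (\<Prod>b\<leftarrow>cs. inner_h (of_h b) g)" if "mset bs = mset cs" for bs cs :: "'a list"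
    using that by (metis mset_map prod_mset_prod_list)
  show "cmod (\<Prod>b\<leftarrow>bs. inner_h (of_h b) g) \<le> (\<Prod>b\<leftarrow>bs. cmod (inner_h (of_h b) g) + cmod (inner_h (of_h b) g))" for bs
    using norm_leibniz_le[of "\<lambda>b. inner_h (of_h b) g" "\<lambda>b. inner_h (of_h b) g" bs]
      norm_ge_zero[of "leibniz (\<lambda>b. inner_h (of_h b) g) (\<lambda>b. inner_h (of_h b) g) bs"] by linarith
qed

text \<open>A vector \<open>E\<close> with these coefficients exists; the terms of the defining
  series are its components of fixed particle number, and their partial sums converge to
  \<open>E\<close>.\<close>

lemma fock_coeff_exp_vec:
  fixes g :: "'a::{real_inner, polish_space} cpx"
  shows "fock_coeff (exp_vec g) bs =
    (if set bs \<subseteq> onb then (\<Prod>b\<leftarrow>bs. inner_h (of_h b) g) / complex_of_real (sqrt (fact (length bs))) else 0)"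
proof -
  define E where "E = to_fock (\<lambda>bs. if set bs \<subseteq> onb
    then (\<Prod>b\<leftarrow>bs. inner_h (of_h b) g) / complex_of_real (sqrt (fact (length bs))) else 0)"
  have E: "fock_coeff E = (\<lambda>bs. if set bs \<subseteq> onb
      then (\<Prod>b\<leftarrow>bs. inner_h (of_h b) g) / complex_of_real (sqrt (fact (length bs))) else 0)"
    unfolding E_def by (rule fock_coeff_to_fock[OF exp_vec_coeff_in_fock_functions])
  have "(1 / sqrt (fact n)) *\<^sub>R tensor_power n g = restr {m. size m = n} E" for n
  proof -
    have "(\<lambda>bs. if set bs \<subseteq> onb \<and> length bs = n then \<Prod>b\<leftarrow>bs. inner_h (of_h b) g else 0) =
        fock_coeff (sqrt (fact n) *\<^sub>R restr {m. size m = n} E)"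
      by (rule ext) (simp add: E restr.rep_eq fock_coeff_simps scaleR_conv_of_real)
    then show ?thesis by (simp add: tensor_power_def to_fock_fock_coeff)
  qed
  moreover have "(\<Sum>n<N. restr {m. size m = n} E) = restr {m. size m < N} E" for N
    by (rule fock_eqI) (simp add: fock_coeff_sum restr.rep_eq)
  moreover have "(\<lambda>N. restr {m. size m < N} E) \<longlonglongrightarrow> E"
    by (rule restr_tendsto) (simp add: eventually_gt_at_top)
  ultimately have "(\<lambda>n. (1 / sqrt (fact n)) *\<^sub>R tensor_power n g) sums E"
    by (simp add: sums_def)
  then have "exp_vec g = E" unfolding exp_vec_def by (rule sums_unique[symmetric])
  then show ?thesis by (simp add: E)
qed

text \<open>The new head \<open>b\<close> contributes a factor that Parseval's identity sums to the
  eigenvalue, while the root of \<open>length bs + 1\<close> lowers the factorial by one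
  step.\<close>

lemma annih_exp_vec:
  fixes g h :: "'a::{real_inner, polish_space} cpx"
  shows "annih h (exp_vec g) = inner_h h g *\<^sub>C exp_vec g"
proof -
  have "complex_of_real (sqrt (real (length bs + 1))) *
     (\<Sum>\<^sub>\<infinity>b\<in>onb. inner_h h (of_h b) * fock_coeff (exp_vec g) (b # bs)) =
     fock_coeff (inner_h h g *\<^sub>C exp_vec g) bs" for bs
  proof (cases "set bs \<subseteq> onb")
    case True
    let ?c = "(\<Prod>b\<leftarrow>bs. inner_h (of_h b) g) / complex_of_real (sqrt (fact (Suc (length bs))))"
    have "(\<Sum>\<^sub>\<infinity>b\<in>onb. inner_h h (of_h b) * fock_coeff (exp_vec g) (b # bs)) =
        (\<Sum>\<^sub>\<infinity>b\<in>onb. inner_h h (of_h b) * inner_h (of_h b) g * ?c)"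
      by (rule infsum_cong) (use True in \<open>simp add: fock_coeff_exp_vec del: fact_Suc\<close>)
    also have "\<dots> = inner_h h g * ?c"
      by (intro infsumI has_sum_cmult_left has_sum_parseval_inner_h)
    finally show ?thesis
      using True by (simp add: fock_coeff_exp_vec fock_coeff_simps scaleC_complex_def real_sqrt_mult)
  next
    case False
    then have "(\<Sum>\<^sub>\<infinity>b\<in>onb. inner_h h (of_h b) * fock_coeff (exp_vec g) (b # bs)) = 0"
      by (intro infsum_0) (simp add: fock_coeff_outside)
    then show ?thesis using False by (simp add: fock_coeff_outside)
  qed
  then show ?thesis by (simp add: annih_def to_fock_fock_coeff)
qed

lemma fock_coeff_creat_exp_vec:
  fixes g h :: "'a::{real_inner, polish_space} cpx"
  shows "fock_coeff (creat h (exp_vec g)) bs = (if set bs \<subseteq> onb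
    then leibniz (\<lambda>b. inner_h (of_h b) h) (\<lambda>b. inner_h (of_h b) g) bs / complex_of_real (sqrt (fact (length bs)))
    else 0)"
proof -
  let ?d = "\<lambda>b. inner_h (of_h b) h" and ?f = "\<lambda>b. inner_h (of_h b) g"
  define F where "F = (\<lambda>bs. if set bs \<subseteq> onb then leibniz ?d ?f bs / complex_of_real (sqrt (fact (length bs))) else 0)"
  have F: "F \<in> fock_functions"
    unfolding F_def
  proof (rule fock_functions_over_sqrt_fact[OF leibniz_perm])
    show "cmod (leibniz ?d ?f bs) \<le> (\<Prod>b\<leftarrow>bs. cmod (?d b) + cmod (?f b))" for bs
      using norm_leibniz_le[of ?d ?f bs] norm_ge_zero[of "\<Prod>b\<leftarrow>bs. ?f b"] by linarith
  qed
  have "complex_of_real (1 / sqrt (real (length bs))) *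
      (\<Sum>j<length bs. ?d (bs ! j) * fock_coeff (exp_vec g) (take j bs @ drop (Suc j) bs)) = F bs"
    if "set bs \<subseteq> onb" for bs
  \<comment> \<open>For the empty list the sum is empty and \<open>leibniz\<close> is zero.
    Otherwise the roots of \<open>Suc n\<close> and \<open>fact n\<close> multiply to the root of
    the required factorial.\<close>
  proof (cases "length bs")
    case (Suc n)
    have "?d (bs ! j) * fock_coeff (exp_vec g) (take j bs @ drop (Suc j) bs) =
        (?d (bs ! j) * (\<Prod>c\<leftarrow>take j bs @ drop (Suc j) bs. ?f c)) / complex_of_real (sqrt (fact n))"
      if "j < length bs" for j
    proof -
      have "set (take j bs @ drop (Suc j) bs) \<subseteq> onb"
        using \<open>set bs \<subseteq> onb\<close> set_take_subset[of j bs] set_drop_subset[of "Suc j" bs] by auto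
      moreover have "length (take j bs @ drop (Suc j) bs) = n" using Suc that by simp
      ultimately show ?thesis unfolding fock_coeff_exp_vec by (simp only: if_True times_divide_eq_right)
    qed
    then have "(\<Sum>j<length bs. ?d (bs ! j) * fock_coeff (exp_vec g) (take j bs @ drop (Suc j) bs)) =
        leibniz ?d ?f bs / complex_of_real (sqrt (fact n))"
      unfolding leibniz_eq_sum sum_divide_distrib by (intro sum.cong refl) blast
    then show ?thesis
      using that Suc by (simp add: F_def real_sqrt_mult)
  qed (simp add: F_def)
  then have "creat h (exp_vec g) = to_fock F"
    unfolding creat_def by (intro arg_cong[where f = to_fock] ext) (auto simp: F_def)
  then show ?thesis by (simp add: fock_coeff_to_fock[OF F]) (simp add: F_def)
qed

section \<open>Inner products of exponential vectors and their images under creation\<close>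

lemma cinner_fock_eq_of_sums:
  fixes x y :: "'a::{real_inner, polish_space} fock"
  assumes "\<And>n. ((\<lambda>bs. cnj (fock_coeff x bs) * fock_coeff y bs) has_sum s n) (lists_length onb n)" "s sums t"
  shows "cinner x y = t"
proof -
  have "((\<lambda>bs. cnj (fock_coeff x bs) * fock_coeff y bs) has_sum cinner x y) {bs. set bs \<subseteq> onb}"
    using has_sum_cinner_fock
    by (rule has_sum_cong_neutral[THEN iffD1, rotated 3]) (auto simp: fock_coeff_outside)
  moreover from this have "((\<lambda>bs. cnj (fock_coeff x bs) * fock_coeff y bs) has_sum t) {bs. set bs \<subseteq> onb}"
    by (intro has_sum_lists_imp_sums[OF _ assms]) (auto simp: summable_on_def)
  ultimately show ?thesis by (rule has_sum_unique)
qed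

lemma cnj_prod_list: "cnj (\<Prod>b\<leftarrow>bs. f b) = (\<Prod>b\<leftarrow>bs. cnj (f b))"
  by (induction bs) simp_all

lemma exp_sums: "(\<lambda>n. (s :: complex) ^ n / fact n) sums exp s"
  using exp_converges[of s] by (simp add: scaleR_conv_of_real field_simps)

lemma cinner_exp_vec:
  fixes f g :: "'a::{real_inner, polish_space} cpx"
  shows "cinner (exp_vec f) (exp_vec g) = exp (inner_h f g)"
proof (rule cinner_fock_eq_of_sums)
  let ?p = "\<lambda>b. inner_h f (of_h b) * inner_h (of_h b) g"
  fix n
  have "(\<lambda>b. norm (?p b)) summable_on onb"
    by (rule has_sum_imp_norm_summable_complex[OF has_sum_parseval_inner_h])
  from has_sum_divide_const[OF has_sum_prod_lists_length(1)[OF has_sum_parseval_inner_h this]]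
  have "((\<lambda>bs. (\<Prod>b\<leftarrow>bs. ?p b) / fact n) has_sum inner_h f g ^ n / fact n) (lists_length onb n)" .
  moreover have "cnj (fock_coeff (exp_vec f) bs) * fock_coeff (exp_vec g) bs = (\<Prod>b\<leftarrow>bs. ?p b) / fact n"
    if "bs \<in> lists_length onb n" for bs
  proof -
    have "cnj (\<Prod>b\<leftarrow>bs. inner_h (of_h b) f) * (\<Prod>b\<leftarrow>bs. inner_h (of_h b) g) = (\<Prod>b\<leftarrow>bs. ?p b)"
      by (induction bs) (simp_all add: inner_h_commute[of f])
    moreover have "complex_of_real (sqrt (fact n)) * complex_of_real (sqrt (fact n)) = fact n"
      by (simp flip: of_real_mult)
    ultimately show ?thesis using that by (simp add: fock_coeff_exp_vec lists_length_def)
  qed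
  ultimately show "((\<lambda>bs. cnj (fock_coeff (exp_vec f) bs) * fock_coeff (exp_vec g) bs) has_sum inner_h f g ^ n / fact n)
      (lists_length onb n)"
    by (simp cong: has_sum_cong)
qed (rule exp_sums)

text \<open>Formally the created vector is the derivative of \<E>(g + t h) at t = 0, so the formula
  differentiates the exponential of an inner product. The computation does this degree by
  degree.\<close>

lemma cinner_exp_vec_creat:
  fixes f g h :: "'a::{real_inner, polish_space} cpx"
  shows "cinner (exp_vec f) (creat h (exp_vec g)) = inner_h f h * cinner (exp_vec f) (exp_vec g)"
  unfolding cinner_exp_vec
proof (rule cinner_fock_eq_of_sums)
  let ?a = "\<lambda>b. inner_h f (of_h b)" and ?d = "\<lambda>b. inner_h (of_h b) h" and ?f = "\<lambda>b. inner_h (of_h b) g"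
  let ?s = "\<lambda>n. of_nat n * inner_h f h * inner_h f g ^ (n - 1) / fact n"
  fix n
  from has_sum_divide_const[OF has_sum_leibniz_lists_length[OF has_sum_parseval_inner_h has_sum_parseval_inner_h]]
  have "((\<lambda>bs. leibniz (\<lambda>b. ?a b * ?d b) (\<lambda>b. ?a b * ?f b) bs / fact n) has_sum ?s n) (lists_length onb n)" .
  moreover have "cnj (fock_coeff (exp_vec f) bs) * fock_coeff (creat h (exp_vec g)) bs =
      leibniz (\<lambda>b. ?a b * ?d b) (\<lambda>b. ?a b * ?f b) bs / fact n"
    if "bs \<in> lists_length onb n" for bs
  proof -
    have "cnj (\<Prod>b\<leftarrow>bs. inner_h (of_h b) f) * leibniz ?d ?f bs = leibniz (\<lambda>b. ?a b * ?d b) (\<lambda>b. ?a b * ?f b) bs"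
      unfolding cnj_prod_list inner_h_commute[of f, symmetric] by (rule leibniz_mult)
    moreover have "complex_of_real (sqrt (fact n)) * complex_of_real (sqrt (fact n)) = fact n"
      by (simp flip: of_real_mult)
    ultimately show ?thesis
      using that by (simp add: fock_coeff_exp_vec fock_coeff_creat_exp_vec lists_length_def)
  qed
  ultimately show "((\<lambda>bs. cnj (fock_coeff (exp_vec f) bs) * fock_coeff (creat h (exp_vec g)) bs) has_sum ?s n)
      (lists_length onb n)"
    by (simp cong: has_sum_cong)
next
  let ?s = "\<lambda>n. of_nat n * inner_h f h * inner_h f g ^ (n - 1) / fact n"
  \<comment> \<open>The term of degree zero vanishes; cancelling \<open>Suc n\<close> against the
    factorial turns the shifted series into the exponential one.\<close>
  have "?s (Suc n) = inner_h f h * (inner_h f g ^ n / fact n)" for n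
    using of_nat_neq_0[of n, where 'a = complex] by (simp add: fact_Suc del: of_nat_Suc)
  then have "(\<lambda>n. ?s (Suc n)) sums (inner_h f h * exp (inner_h f g))"
    using sums_mult[OF exp_sums] by simp
  from sums_Suc[OF this] show "?s sums (inner_h f h * exp (inner_h f g))" by simp
qed

lemma cinner_creat_exp_vec:
  fixes f g h :: "'a::{real_inner, polish_space} cpx"
  shows "cinner (creat h (exp_vec f)) (exp_vec g) = inner_h h g * cinner (exp_vec f) (exp_vec g)"
proof -
  have "cinner (creat h (exp_vec f)) (exp_vec g) = cnj (inner_h g h * cinner (exp_vec g) (exp_vec f))"
    by (metis cinner_commute cinner_exp_vec_creat)
  also have "\<dots> = inner_h h g * cinner (exp_vec f) (exp_vec g)"
    by (metis cinner_commute complex_cnj_mult inner_h_commute)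
  finally show ?thesis .
qed

section \<open>Totality of the exponential vectors\<close>

text \<open>Totality is phrased as: every such set that contains the exponential vectors is the
  whole space. Keeping the set variable allows passing to preimages under operators.\<close>

definition closed_csubspace :: "'h::complex_inner set \<Rightarrow> bool" where
  "closed_csubspace V \<longleftrightarrow> closed V \<and> 0 \<in> V \<and> (\<forall>x\<in>V. \<forall>y\<in>V. x + y \<in> V) \<and> (\<forall>c. \<forall>x\<in>V. c *\<^sub>C x \<in> V)"

lemma closed_csubspace_scaleR: "closed_csubspace V \<Longrightarrow> x \<in> V \<Longrightarrow> r *\<^sub>R x \<in> V"
  by (simp add: closed_csubspace_def scaleR_scaleC)

lemma closed_csubspace_sum:
  assumes "closed_csubspace V" "\<And>i. i \<in> I \<Longrightarrow> x i \<in> V"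
  shows "(\<Sum>i\<in>I. x i) \<in> V"
  using assms(2) by (induction I rule: infinite_finite_induct) (use assms(1) in \<open>auto simp: closed_csubspace_def\<close>)

lemma closed_csubspace_diff:
  assumes "closed_csubspace V" "x \<in> V" "y \<in> V"
  shows "x - y \<in> V"
proof -
  have "x + (-1) *\<^sub>R y \<in> V" using assms closed_csubspace_scaleR[OF assms(1,3)] by (simp only: closed_csubspace_def)
  then show ?thesis by simp
qed

lemma closed_csubspace_vimage:
  fixes T :: "'h::complex_inner \<Rightarrow> 'k::complex_inner"
  assumes "closed_csubspace V" "bounded_linear T" "\<And>c x. T (c *\<^sub>C x) = c *\<^sub>C T x"
  shows "closed_csubspace {x. T x \<in> V}"
proof -
  interpret bounded_linear T by fact
  have "closed (T -` V)"
    using assms(1) continuous_on by (intro continuous_closed_vimage) (auto simp: closed_csubspace_def isCont)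
  then show ?thesis
    using assms(1,3) by (simp add: closed_csubspace_def vimage_def add zero)
qed

text \<open>
  Scaling the coordinate of \<open>g\<close> along \<open>b\<close> by \<open>t\<close> multiplies the component of the exponential vector
  with \<open>k\<close> factors \<open>b\<close> by \<open>t ^ k\<close>; dividing by powers of \<open>t\<close> and letting \<open>t\<close> tend to \<open>0\<close> extracts the
  components one by one.
\<close>

lemma restr_count_exp_vec_mem:
  fixes g :: "'a::{real_inner, polish_space} cpx"
  assumes V: "closed_csubspace V" and E: "\<And>g :: 'a cpx. exp_vec g \<in> V" and b: "b \<in> onb"
  shows "restr {m. count m b = k} (exp_vec g) \<in> V"
proof (induction k rule: less_induct)
  case (less n)
  define \<psi> where "\<psi> k = restr {m. count m b = k} (exp_vec g)" for k
  define G where "G t = (fst g + ((t - 1) * inner b (fst g)) *\<^sub>R b, snd g + ((t - 1) * inner b (snd g)) *\<^sub>R b)" for t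
  have coord: "inner_h (of_h c) (G t) = (if c = b then complex_of_real t else 1) * inner_h (of_h c) g"
    if "c \<in> onb" for c t
    using inner_onb[OF that b] by (auto simp: inner_h_def of_h_def G_def complex_eq_iff inner_add_right algebra_simps)
  have prod: "(\<Prod>c\<leftarrow>bs. inner_h (of_h c) (G t)) = complex_of_real (t ^ count (mset bs) b) * (\<Prod>c\<leftarrow>bs. inner_h (of_h c) g)"
    if "set bs \<subseteq> onb" for bs t
    using that by (induction bs) (auto simp: coord)
  have EG: "fock_coeff (exp_vec (G t)) bs = complex_of_real (t ^ count (mset bs) b) * fock_coeff (exp_vec g) bs" for t bs
    by (simp add: fock_coeff_exp_vec prod)
  \<comment> \<open>Components with fewer than \<open>n\<close> factors \<open>b\<close> lie in
    \<open>V\<close> by induction and are removed; after division by \<open>t ^ n\<close> only the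
    wanted component and terms of positive order in \<open>t\<close> remain.\<close>
  define y where "y t = (1 / t ^ n) *\<^sub>R (exp_vec (G t) - (\<Sum>k<n. t ^ k *\<^sub>R \<psi> k))" for t
  have yV: "y t \<in> V" for t
    unfolding y_def using less
    by (intro closed_csubspace_scaleR[OF V] closed_csubspace_diff[OF V] closed_csubspace_sum[OF V] E) (simp add: \<psi>_def)
  have "norm (y t - \<psi> n) \<le> t * norm (exp_vec g)" if t: "0 < t" "t \<le> 1" for t
  proof (rule norm_fock_le)
    fix bs
    let ?c = "fock_coeff (exp_vec g) bs" and ?k = "count (mset bs) b"
    have "(\<Sum>k<n. fock_coeff (t ^ k *\<^sub>R \<psi> k) bs) = (\<Sum>k<n. if k = ?k then complex_of_real (t ^ ?k) * ?c else 0)"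
      by (intro sum.cong refl) (auto simp: \<psi>_def restr.rep_eq fock_coeff_simps scaleR_conv_of_real)
    then have "fock_coeff (y t - \<psi> n) bs =
        (if n < ?k then complex_of_real (t ^ ?k / t ^ n) * ?c else 0)"
      using t by (auto simp: y_def \<psi>_def restr.rep_eq fock_coeff_simps fock_coeff_sum EG scaleR_conv_of_real)
    \<comment> \<open>One bound for all higher powers, thanks to \<open>t \<le> 1\<close>, turns the
      coefficientwise estimate into an estimate of norms.\<close>
    moreover have "t ^ ?k / t ^ n \<le> t" if "n < ?k"
    proof -
      have "t ^ ?k \<le> t ^ Suc n" using that t by (intro power_decreasing) auto
      then show ?thesis using t by (simp add: divide_simps mult.commute)
    qed
    ultimately show "cmod (fock_coeff (y t - \<psi> n) bs) \<le> t * cmod ?c"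
      using t mult_right_mono[of "t ^ ?k / t ^ n" t "cmod ?c"] by (auto simp: norm_mult norm_divide norm_power)
  qed (use t in simp)
  then have "\<forall>\<^sub>F t in at_right 0. norm (y t - \<psi> n) \<le> t * norm (exp_vec g)"
    unfolding eventually_at_right_field by (intro exI[of _ 1]) auto
  moreover have "((\<lambda>t. t * norm (exp_vec g)) \<longlongrightarrow> 0) (at_right 0)"
    by (auto intro!: tendsto_eq_intros)
  ultimately have "((\<lambda>t. y t - \<psi> n) \<longlongrightarrow> 0) (at_right 0)"
    by (rule Lim_null_comparison)
  then have "(y \<longlongrightarrow> \<psi> n) (at_right 0)" by (rule LIM_zero_cancel)
  then have "\<psi> n \<in> V"
    using V yV by (intro Lim_in_closed_set[of V y]) (auto simp: closed_csubspace_def)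
  then show ?case by (simp add: \<psi>_def)
qed

text \<open>\<open>V\<close> stays arbitrary in the induction: its preimage under the restriction
  for a new \<open>b\<close> is again a closed subspace, and it contains all exponential vectors by
  the case of one coordinate.\<close>

lemma restr_counts_exp_vec_mem:
  fixes g :: "'a::{real_inner, polish_space} cpx"
  assumes "finite J" "J \<subseteq> onb" "closed_csubspace V" "\<And>g :: 'a cpx. exp_vec g \<in> V"
  shows "restr {m. \<forall>b\<in>J. count m b = k b} (exp_vec g) \<in> V"
  using assms
proof (induction J arbitrary: V rule: finite_induct)
  case empty
  have "restr UNIV (exp_vec g) = exp_vec g" by (rule fock_eqI) (simp add: restr.rep_eq)
  then show ?case using empty by simp
next
  case (insert b J)
  let ?T = "restr {m. count m b = k b} :: 'a fock \<Rightarrow> 'a fock"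
  have "closed_csubspace {x. ?T x \<in> V}"
    by (intro closed_csubspace_vimage insert.prems bounded_linear_restr restr_scaleC)
  moreover have "exp_vec g \<in> {x. ?T x \<in> V}" for g
    using restr_count_exp_vec_mem[OF insert.prems(2,3)] insert.prems(1) by simp
  ultimately have "?T (restr {m. \<forall>b\<in>J. count m b = k b} (exp_vec g)) \<in> V"
    using insert.IH insert.prems(1) by blast
  moreover have "?T (restr {m. \<forall>b\<in>J. count m b = k b} (exp_vec g)) = restr {m. \<forall>b\<in>insert b J. count m b = k b} (exp_vec g)"
    by (rule fock_eqI) (simp add: restr.rep_eq)
  ultimately show ?case by simp
qed

lemma restr_singleton_mem:
  fixes \<psi> :: "'a::{real_inner, polish_space} fock"
  assumes V: "closed_csubspace V" and E: "\<And>g :: 'a cpx. exp_vec g \<in> V"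
  shows "restr {m} \<psi> \<in> V"
proof (cases "set_mset m \<subseteq> onb")
  case False
  have "restr {m} \<psi> = 0"
    by (rule fock_eqI) (use False in \<open>auto simp: restr.rep_eq fock_coeff_simps intro!: fock_coeff_outside\<close>)
  then show ?thesis using V by (simp add: closed_csubspace_def)
next
  case True
  \<comment> \<open>The coordinates of \<open>g\<close> are one on the entries of \<open>m\<close>
    and zero elsewhere in the basis. Its exponential vector is supported on lists over these
    entries, and there the prescribed counts single out \<open>m\<close>.\<close>
  define g where "g = of_h (\<Sum>b\<in>set_mset m. b)"
  have g: "inner_h (of_h c) g = (if c \<in># m then 1 else 0)" if "c \<in> onb" for c
  proof -
    have "inner c (\<Sum>b\<in>set_mset m. b) = (\<Sum>b\<in>set_mset m. if b = c then 1 else 0)"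
      unfolding inner_sum_right using that True by (intro sum.cong refl) (auto simp: inner_onb)
    then show ?thesis by (simp add: g_def inner_h_def of_h_def complex_eq_iff)
  qed
  have prod: "(\<Prod>b\<leftarrow>bs. inner_h (of_h b) g) = (if set bs \<subseteq> set_mset m then 1 else 0)" if "set bs \<subseteq> onb" for bs
    using that by (induction bs) (auto simp: g)
  obtain cs where cs: "mset cs = m" using ex_mset by blast
  \<comment> \<open>By symmetry one list \<open>cs\<close> supplies the coefficient; the root of the
    factorial undoes the normalisation of the exponential vector.\<close>
  have eq: "restr {m} \<psi> = (complex_of_real (sqrt (fact (size m))) * fock_coeff \<psi> cs) *\<^sub>C
      restr {m'. \<forall>b\<in>set_mset m. count m' b = count m b} (exp_vec g)"
  proof (rule fock_eqI)
    fix bs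
    show "fock_coeff (restr {m} \<psi>) bs = fock_coeff ((complex_of_real (sqrt (fact (size m))) * fock_coeff \<psi> cs) *\<^sub>C
      restr {m'. \<forall>b\<in>set_mset m. count m' b = count m b} (exp_vec g)) bs"
    proof (cases "mset bs = m")
      case t: True
      then have "set bs \<subseteq> onb" "set bs \<subseteq> set_mset m" "length bs = size m"
        using True by auto
      then show ?thesis
        using t cs fock_coeff_perm[of bs cs \<psi>]
        by (simp add: restr.rep_eq fock_coeff_simps fock_coeff_exp_vec prod scaleC_complex_def)
    next
      case f: False
      have "\<not> (set bs \<subseteq> onb \<and> set bs \<subseteq> set_mset m \<and> (\<forall>b\<in>set_mset m. count (mset bs) b = count m b))"
      proof
        assume *: "set bs \<subseteq> onb \<and> set bs \<subseteq> set_mset m \<and> (\<forall>b\<in>set_mset m. count (mset bs) b = count m b)"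
        have "mset bs = m"
        proof (rule multiset_eqI)
          show "count (mset bs) b = count m b" for b
          proof (cases "b \<in># m")
            case False
            then have "b \<notin># mset bs" using * by auto
            then show ?thesis using False by (simp only: not_in_iff)
          qed (use * in blast)
        qed
        with f show False ..
      qed
      then show ?thesis
        using f by (auto simp: restr.rep_eq fock_coeff_simps fock_coeff_exp_vec prod scaleC_complex_def)
    qed
  qed
  have "restr {m'. \<forall>b\<in>set_mset m. count m' b = count m b} (exp_vec g) \<in> V"
    by (rule restr_counts_exp_vec_mem) (use True V E in auto)
  then show ?thesis unfolding eq using V by (simp add: closed_csubspace_def)
qed

lemma exp_vec_total:
  fixes V :: "'a::{real_inner, polish_space} fock set"
  assumes V: "closed_csubspace V" and E: "\<And>g :: 'a cpx. exp_vec g \<in> V"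
  shows "\<psi> \<in> V"
proof (rule Lim_in_closed_set)
  show "closed V" using V by (simp add: closed_csubspace_def)
  have "restr M \<psi> \<in> V" if "finite M" for M
  proof -
    have "restr M \<psi> = (\<Sum>m\<in>M. restr {m} \<psi>)"
      by (rule fock_eqI) (use that in \<open>simp add: restr.rep_eq fock_coeff_sum\<close>)
    then show ?thesis by (simp add: closed_csubspace_sum[OF V restr_singleton_mem[OF V E]])
  qed
  then show "\<forall>\<^sub>F M in finite_subsets_at_top UNIV. restr M \<psi> \<in> V"
    by (rule eventually_finite_subsets_at_top_weakI)
  show "((\<lambda>M. restr M \<psi>) \<longlongrightarrow> \<psi>) (finite_subsets_at_top UNIV)"
  proof (rule restr_tendsto)
    show "\<forall>\<^sub>F M in finite_subsets_at_top UNIV. m \<in> M" for m :: "'a multiset"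
      unfolding eventually_finite_subsets_at_top by (intro exI[of _ "{m}"]) auto
  qed
qed simp

section \<open>Operators and vectors determined by exponential vectors\<close>

lemma bounded_clinear_eqI:
  fixes S T :: "'a::{real_inner, polish_space} fock \<Rightarrow> 'h::complex_inner"
  assumes S: "bounded_clinear S" and T: "bounded_clinear T" and "\<And>g. S (exp_vec g) = T (exp_vec g)"
  shows "S = T"
proof
  fix \<psi>
  have "closed_csubspace {0 :: 'h}" by (simp add: closed_csubspace_def scaleC_zero)
  then have "closed_csubspace {\<psi>. S \<psi> - T \<psi> \<in> {0}}"
  proof (rule closed_csubspace_vimage)
    show "bounded_linear (\<lambda>\<psi>. S \<psi> - T \<psi>)"
      using S T by (intro bounded_linear_sub) (auto simp: bounded_clinear_def)
    have "c *\<^sub>C (x - y) = c *\<^sub>C x - c *\<^sub>C y" for c and x y :: 'h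
      by (metis add_diff_cancel_right' diff_add_cancel scaleC_add_right)
    then show "S (c *\<^sub>C x) - T (c *\<^sub>C x) = c *\<^sub>C (S x - T x)" for c x
      using S T by (simp add: bounded_clinear_def)
  qed
  then have "\<psi> \<in> {\<psi>. S \<psi> - T \<psi> \<in> {0}}"
    by (rule exp_vec_total) (simp add: assms(3))
  then show "S \<psi> = T \<psi>" by simp
qed

lemma cinner_zero_right: "cinner x (0::'h::complex_inner) = 0"
  using cinner_scaleC_right[of x 0 0] by (simp add: scaleC_zero)

lemma cinner_diff_right: "cinner x (y - z) = cinner x y - cinner x (z::'h::complex_inner)"
  by (metis add_diff_cancel_right' cinner_add_right diff_add_cancel)

lemma bounded_linear_cinner_right: "bounded_linear (cinner (x::'h::complex_inner))"
proof (rule bounded_linear_intro)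
  show "cinner x (r *\<^sub>R y) = r *\<^sub>R cinner x y" for r y
    by (simp add: scaleR_scaleC cinner_scaleC_right scaleC_complex_def)
  show "norm (cinner x y) \<le> norm y * norm x" for y
    using norm_cinner_le[of x y] by (simp add: mult.commute)
qed (rule cinner_add_right)

lemma fock_eq_if_cinner_exp_vec:
  fixes x y :: "'a::{real_inner, polish_space} fock"
  assumes "\<And>g. cinner x (exp_vec g) = cinner y (exp_vec g)"
  shows "x = y"
proof -
  have "cinner x = cinner y"
    by (rule bounded_clinear_eqI)
      (simp_all add: bounded_clinear_def bounded_linear_cinner_right cinner_scaleC_right scaleC_complex_def assms)
  then have "cinner (x - y) x = cinner (x - y) y"
    by (metis cinner_commute cinner_diff_right)
  then have "cinner (x - y) (x - y) = 0" by (simp add: cinner_diff_right)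
  then show ?thesis by (simp add: cinner_self)
qed

lemma bounded_clinear_eqI_cinner:
  fixes S T :: "'a::{real_inner, polish_space} fock \<Rightarrow> 'a fock"
  assumes "bounded_clinear S" "bounded_clinear T"
    and eq: "\<And>f g. cinner (exp_vec f) (S (exp_vec g)) = cinner (exp_vec f) (T (exp_vec g))"
  shows "S = T"
proof (rule bounded_clinear_eqI[OF assms(1,2)])
  show "S (exp_vec g) = T (exp_vec g)" for g
    by (rule fock_eq_if_cinner_exp_vec) (metis cinner_commute eq)
qed

section \<open>Matrix elements of the divergence\<close>

text \<open>Linearity passes from the generators to the algebra; it is used to move sums and scalars
  through \<open>F\<close> in matrix elements.\<close>

lemma Smooth_ops_linear:
  assumes "F \<in> Smooth_ops"
  shows "F (x + y) = F x + F y" "F (c *\<^sub>C x) = c *\<^sub>C F x"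
proof -
  have "(\<forall>x y. F (x + y) = F x + F y) \<and> (\<forall>c x. F (c *\<^sub>C x) = c *\<^sub>C F x)"
    using assms
  proof induction
    case (gen \<phi> h M)
    then show ?case by (auto simp: is_O_def bounded_clinear_def dest: linear_add[OF bounded_linear.linear])
  qed (simp_all add: scaleC_add_right scaleC_scaleC mult.commute)
  then show "F (x + y) = F x + F y" "F (c *\<^sub>C x) = c *\<^sub>C F x" by blast+
qed

lemma defines_boundedD:
  "defines_bounded S M \<Longrightarrow> cinner (exp_vec f) (M (exp_vec g)) =
    (\<Sum>(X, B, Y)\<leftarrow>S. cinner (adj_exp X f) (B (Y (exp_vec g))))"
  unfolding defines_bounded_def by blast

text \<open>Totality gives the uniqueness that the definite description calls for.\<close>

lemma adj_exp_eqI: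
  fixes f :: "'a::{real_inner, polish_space} cpx"
  assumes "\<And>g. cinner w (exp_vec g) = cinner (exp_vec f) (X (exp_vec g))"
  shows "adj_exp X f = w"
  unfolding adj_exp_def using assms by (intro the_equality) (auto intro: fock_eq_if_cinner_exp_vec)

lemma adj_exp_id: "adj_exp id f = exp_vec (f :: 'a::{real_inner, polish_space} cpx)"
  by (rule adj_exp_eqI) simp

text \<open>Creation is adjoint to annihilation on exponential vectors: eigenvalue terms of
  \<open>X\<close> become creation terms on \<E>(f) and conversely, with conjugated
  coefficients.\<close>

lemma adj_exp_linear_combination:
  fixes f h\<^sub>1 h\<^sub>2 k\<^sub>1 k\<^sub>2 :: "'a::{real_inner, polish_space} cpx"
  assumes "\<And>g. X (exp_vec g) = (\<alpha>\<^sub>1 * inner_h k\<^sub>1 g + \<alpha>\<^sub>2 * inner_h k\<^sub>2 g) *\<^sub>C exp_vec g +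
    \<gamma>\<^sub>1 *\<^sub>C creat h\<^sub>1 (exp_vec g) + \<gamma>\<^sub>2 *\<^sub>C creat h\<^sub>2 (exp_vec g)"
  shows "adj_exp X f = cnj \<alpha>\<^sub>1 *\<^sub>C creat k\<^sub>1 (exp_vec f) + cnj \<alpha>\<^sub>2 *\<^sub>C creat k\<^sub>2 (exp_vec f) +
    (cnj \<gamma>\<^sub>1 * inner_h h\<^sub>1 f + cnj \<gamma>\<^sub>2 * inner_h h\<^sub>2 f) *\<^sub>C exp_vec f"
  by (rule adj_exp_eqI)
    (simp add: assms cinner_add_left cinner_add_right cinner_scaleC_left cinner_scaleC_right
      cinner_exp_vec_creat cinner_creat_exp_vec inner_h_commute[of f] algebra_simps)

lemma scaleC_minus_one: "- x = (-1) *\<^sub>C (x :: 'h::complex_inner)"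
  using scaleR_scaleC[of "-1" x] by simp

text \<open>The two combinations share their annihilation part, and their creation parts are
  opposite.\<close>

lemma PQ_exp_vec:
  fixes h\<^sub>1 h\<^sub>2 g :: "'a::{real_inner, polish_space} cpx"
  shows "(1 / 2) *\<^sub>C (P_op h\<^sub>1 (exp_vec g) + Q_op h\<^sub>2 (exp_vec g)) =
      ((\<i> / 2) * inner_h (conj_h h\<^sub>1) g + (1 / 2) * inner_h (conj_h h\<^sub>2) g) *\<^sub>C exp_vec g +
      (- \<i> / 2) *\<^sub>C creat h\<^sub>1 (exp_vec g) + (1 / 2) *\<^sub>C creat h\<^sub>2 (exp_vec g)" (is ?PQ)
    and "(\<i> / 2) *\<^sub>C (Q_op h\<^sub>1 (exp_vec g) - P_op h\<^sub>2 (exp_vec g)) =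
      ((\<i> / 2) * inner_h (conj_h h\<^sub>1) g + (1 / 2) * inner_h (conj_h h\<^sub>2) g) *\<^sub>C exp_vec g +
      (\<i> / 2) *\<^sub>C creat h\<^sub>1 (exp_vec g) + (- 1 / 2) *\<^sub>C creat h\<^sub>2 (exp_vec g)" (is ?QP)
proof -
  show ?PQ ?QP
    by (rule fock_eqI; simp add: P_op_def Q_op_def annih_exp_vec fock_coeff_simps scaleC_complex_def algebra_simps)+
qed

text \<open>Both sides are the symmetric bilinear extension of the real inner product. Swapping puts
  \<open>h\<close> into the linear slot, so annihilation eigenvalues become functionals of
  \<open>h\<close> represented by \<open>conj_h g\<close>.\<close>

lemma inner_h_conj_h: "inner_h (conj_h h) g = inner_h (conj_h g) h"
  by (simp add: inner_h_def conj_h_def complex_eq_iff inner_commute)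

lemma divergence_terms_matrix_element:
  fixes f g :: "'a::{real_inner, polish_space} cpx"
  assumes F: "F \<in> Smooth_ops" and D: "is_D h F G"
  shows "(\<Sum>(X, B, Y)\<leftarrow>divergence_terms (F, h) G. cinner (adj_exp X f) (B (Y (exp_vec g)))) =
    (- \<i> * inner_h f (fst h) + \<i> * inner_h (conj_h g) (fst h) + inner_h f (snd h) + inner_h (conj_h g) (snd h)) *
      cinner (exp_vec f) (F (exp_vec g))"
proof -
  let ?X = "\<lambda>\<psi>. (1 / 2) *\<^sub>C (P_op (fst h) \<psi> + Q_op (snd h) \<psi>)"
  let ?Y = "\<lambda>\<psi>. (\<i> / 2) *\<^sub>C (Q_op (fst h) \<psi> - P_op (snd h) \<psi>)"
  note X = adj_exp_linear_combination[of ?X, OF PQ_exp_vec(1), of f]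
  note Y = adj_exp_linear_combination[of ?Y, OF PQ_exp_vec(2), of f]
  have G: "cinner (exp_vec f) (G (exp_vec g)) =
      cinner (adj_exp ?Y f) (F (exp_vec g)) + cinner (exp_vec f) (F (- ?Y (exp_vec g)))"
    using defines_boundedD[OF D[unfolded is_D_def Let_def], of f g] by (simp add: adj_exp_id)
  have "(\<Sum>(X, B, Y)\<leftarrow>divergence_terms (F, h) G. cinner (adj_exp X f) (B (Y (exp_vec g)))) =
      cinner (adj_exp ?X f) (F (exp_vec g)) + cinner (exp_vec f) (F (?X (exp_vec g))) -
      cinner (exp_vec f) (G (exp_vec g))"
    by (simp add: divergence_terms_def Let_def adj_exp_id cinner_scaleC_right scaleC_minus_one[of "G _"])
  also have "\<dots> = (- \<i> * inner_h f (fst h) + \<i> * inner_h (conj_h g) (fst h) + inner_h f (snd h) + inner_h (conj_h g) (snd h)) *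
      cinner (exp_vec f) (F (exp_vec g))"
    \<comment> \<open>Terms with a created particle in \<E>(f) or \<E>(g) cancel between
      \<open>?X\<close> and \<open>?Y\<close>; the scalar terms add up in pairs, which removes the
      halves.\<close>
    unfolding G X Y PQ_exp_vec scaleC_minus_one[of "_ + _"]
    by (simp add: Smooth_ops_linear[OF F] cinner_add_left cinner_add_right cinner_scaleC_left cinner_scaleC_right
      inner_h_commute[of f] inner_h_conj_h[of "fst h"] inner_h_conj_h[of "snd h"] algebra_simps)
  finally show ?thesis .
qed

lemma tensor_coeff_tensor_h:
  fixes k :: "'a::{real_inner, polish_space} cpx"
  shows "tensor_coeff (tensor_h \<psi> k) = (\<lambda>b. if b \<in> onb then inner_h (of_h b) k *\<^sub>C \<psi> else 0)"
proof -
  have "(\<lambda>b. (cmod (inner_h (of_h b) k))\<^sup>2 * (norm \<psi>)\<^sup>2) summable_on onb"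
    by (rule summable_on_cmult_left[OF summable_on_norm_inner_h])
  then have "square_summable (\<lambda>b. if b \<in> onb then inner_h (of_h b) k *\<^sub>C \<psi> else 0)"
    unfolding square_summable_def
    by (rule summable_on_cong_neutral[THEN iffD1, rotated 3]) (auto simp: norm_scaleC power_mult_distrib)
  then show ?thesis
    unfolding tensor_h_def by (intro Abs_htensor_inverse) auto
qed

lemma cinner_tensor_h:
  fixes k l :: "'a::{real_inner, polish_space} cpx"
  shows "cinner (tensor_h \<phi> k) (tensor_h \<psi> l) = inner_h k l * cinner \<phi> \<psi>"
proof -
  have "((\<lambda>b. inner_h k (of_h b) * inner_h (of_h b) l * cinner \<phi> \<psi>) has_sum inner_h k l * cinner \<phi> \<psi>) onb"
    by (rule has_sum_cmult_left[OF has_sum_parseval_inner_h])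
  then have "((\<lambda>b. cinner (tensor_coeff (tensor_h \<phi> k) b) (tensor_coeff (tensor_h \<psi> l) b)) has_sum
      inner_h k l * cinner \<phi> \<psi>) UNIV"
    by (rule has_sum_cong_neutral[THEN iffD1, rotated 3])
      (auto simp: tensor_coeff_tensor_h cinner_zero_right cinner_scaleC_left cinner_scaleC_right inner_h_commute[of k])
  then show ?thesis
    by (simp add: cinner_htensor.rep_eq l2_cinner_def infsumI)
qed

text \<open>The vector \<open>\<E>(f) \<otimes> (i (f - g\<^sup>*), f + g\<^sup>*)\<close>, where \<open>g\<^sup>*\<close> is the conjugate of \<open>g\<close>.\<close>

definition divergence_dual :: "'a::real_inner cpx \<Rightarrow> 'a cpx \<Rightarrow> 'a fock_tensor" where
  "divergence_dual f g =
     (tensor_h (exp_vec f) (- snd f - snd g, fst f - fst g), tensor_h (exp_vec f) (f + conj_h g))"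

lemma cinner_divergence_dual:
  fixes f g :: "'a::{real_inner, polish_space} cpx"
  shows "cinner (divergence_dual f g) (tensor_op F h \<psi>) =
    (- \<i> * inner_h f (fst h) + \<i> * inner_h (conj_h g) (fst h) + inner_h f (snd h) + inner_h (conj_h g) (snd h)) *
      cinner (exp_vec f) (F \<psi>)"
proof -
  \<comment> \<open>Multiplication by the imaginary unit sends a pair \<open>(x, y)\<close> to
    \<open>(- y, x)\<close>. The left slot is conjugate linear, so the unit comes out as
    \<open>- \<i>\<close>.\<close>
  have 1: "inner_h (- snd f - snd g, fst f - fst g) (fst h) = - \<i> * inner_h f (fst h) + \<i> * inner_h (conj_h g) (fst h)"
    by (simp add: inner_h_def conj_h_def complex_eq_iff inner_diff_left)
  have 2: "inner_h (f + conj_h g) (snd h) = inner_h f (snd h) + inner_h (conj_h g) (snd h)"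
    by (simp add: inner_h_def complex_eq_iff inner_add_left)
  show ?thesis
    unfolding divergence_dual_def tensor_op_def cinner_prod_def fst_conv snd_conv cinner_tensor_h 1 2
    by (simp add: algebra_simps)
qed

lemma cinner_sum_list_right: "cinner (x::'h::complex_inner) (\<Sum>i\<leftarrow>is. y i) = (\<Sum>i\<leftarrow>is. cinner x (y i))"
  by (induction "is") (simp_all add: cinner_zero_right cinner_add_right)

text \<open>Both sides are additive over the summands of a representation, so induction along the
  parallel lists \<open>Fs\<close> and \<open>Gs\<close> reduces to a single term.\<close>

lemma cinner_is_divergence:
  fixes f g :: "'a::{real_inner, polish_space} cpx"
  assumes "is_divergence u d"
  shows "cinner (exp_vec f) (d (exp_vec g)) = cinner (divergence_dual f g) (u (exp_vec g))"
proof -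
  obtain Fs Gs where Fs: "fst ` set Fs \<subseteq> Smooth_ops" "u = sum_tensor_ops Fs"
    "list_all2 (\<lambda>(F, h) G. is_D h F G) Fs Gs" "defines_bounded (concat (map2 divergence_terms Fs Gs)) d"
    using assms unfolding is_divergence_def by blast
  have "(\<Sum>(X, B, Y)\<leftarrow>concat (map2 divergence_terms Fs Gs). cinner (adj_exp X f) (B (Y (exp_vec g)))) =
      (\<Sum>(F, h)\<leftarrow>Fs. cinner (divergence_dual f g) (tensor_op F h (exp_vec g)))"
    using Fs(3,1)
  proof (induction rule: list_all2_induct)
    case (Cons Fh Fs G Gs)
    obtain F h where Fh: "Fh = (F, h)" by (cases Fh)
    show ?case
      using divergence_terms_matrix_element[of F h G f g] Cons by (simp add: Fh cinner_divergence_dual)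
  qed simp
  also have "\<dots> = cinner (divergence_dual f g) (u (exp_vec g))"
    by (simp add: Fs(2) sum_tensor_ops_def cinner_sum_list_right case_prod_unfold)
  finally show ?thesis by (simp only: defines_boundedD[OF Fs(4)])
qed

text \<open>Matrix elements between exponential vectors fix a bounded operator, so the definite
  description denotes.\<close>

lemma is_divergence_divergence:
  fixes u :: "'a::{real_inner, polish_space} fock \<Rightarrow> 'a fock_tensor"
  assumes "u \<in> S_h_delta"
  shows "is_divergence u (divergence u)"
proof -
  obtain d where d: "is_divergence u d" using assms by (auto simp: S_h_delta_def)
  have "d' = d" if "is_divergence u d'" for d'
  proof (rule bounded_clinear_eqI_cinner)
    show "bounded_clinear d'" "bounded_clinear d"
      using that d by (auto simp: is_divergence_def defines_bounded_def)
  qed (simp add: cinner_is_divergence[OF that] cinner_is_divergence[OF d])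
  with d show ?thesis unfolding divergence_def by (rule theI)
qed

theorem corollary6p6p7:
  fixes u :: "nat \<Rightarrow> 'a::{real_inner, polish_space} fock \<Rightarrow> 'a fock_tensor"
    and \<beta> :: "'a fock \<Rightarrow> 'a fock"
  assumes "\<And>n. u n \<in> S_h_delta"
    and "weakly_tends u (\<lambda>_. 0)"
    and "bounded_clinear \<beta>"
    and "weakly_tends (\<lambda>n. divergence (u n)) \<beta>"
  shows "\<beta> = (\<lambda>_. 0)"
proof (rule bounded_clinear_eqI_cinner[OF assms(3)])
  show "bounded_clinear (\<lambda>_ :: 'a fock. 0 :: 'a fock)"
    by (simp add: bounded_clinear_def scaleC_zero)
  fix f g :: "'a cpx"
  have "(\<lambda>n. cinner (exp_vec f) (divergence (u n) (exp_vec g))) \<longlonglongrightarrow> cinner (exp_vec f) (\<beta> (exp_vec g))"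
    using assms(4) by (simp add: weakly_tends_def)
  \<comment> \<open>Weak convergence of \<open>u\<close> is tested on the single pair
    \<open>divergence_dual f g\<close> and \<open>exp_vec g\<close>.\<close>
  moreover have "(\<lambda>n. cinner (exp_vec f) (divergence (u n) (exp_vec g))) \<longlonglongrightarrow> 0"
    using assms(2) unfolding cinner_is_divergence[OF is_divergence_divergence[OF assms(1)]]
      weakly_tends_def cinner_zero_right by blast
  ultimately show "cinner (exp_vec f) (\<beta> (exp_vec g)) = cinner (exp_vec f) 0"
    by (simp add: cinner_zero_right LIMSEQ_unique)
qed

end
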